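(* Let $\Omega\subset\mathbb{R}^3$ be a bounded domain with smooth boundary surface $S$, let $\mathbf{n}(\mathbf{x})$ denote the outward unit normal at $\mathbf{x}\in S$, and let $f:S\to\mathbb{R}$ be smooth. For $\mathbf{y}\in S$ let $$v(\mathbf{y})=\int_S \frac{\bigl(f(\mathbf{x})\mathbf{n}(\mathbf{y})+f(\mathbf{y})\mathbf{n}(\mathbf{x})\bigr)\cdot(\mathbf{y}-\mathbf{x})}{4\pi|\mathbf{x}-\mathbf{y}|^3}\,dS(\mathbf{x})+\tfrac12 f(\mathbf{y}),$$ and for $\delta>0$ let $$v_\delta(\mathbf{y})=\int_S \frac{\bigl(f(\mathbf{x})\mathbf{n}(\mathbf{y})+f(\mathbf{y})\mathbf{n}(\mathbf{x})\bigr)\cdot(\mathbf{y}-\mathbf{x})\; s(|\mathbf{x}-\mathbf{y}|/\delta)}{4\pi|\mathbf{x}-\mathbf{y}|^3}\,dS(\mathbf{x})+\tfrac12 f(\mathbf{y}),$$ where $$s(\rho)=\operatorname{erf}(\rho)-\frac{2}{\sqrt{\pi}}\,\rho\, e^{-\rho^2}.$$ Then for every $\mathbf{y}\in S$, $v_\delta(\mathbf{y})-v(\mathbf{y})=O(\delta^3)$ as $\delta\to0^+$.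
   Context: $\operatorname{erf}(\rho)=\frac{2}{\sqrt{\pi}}\int_0^\rho e^{-t^2}\,dt$ is the error function. The quantity $v(\mathbf{y})$ is the adjoint double layer potential $\int_S \frac{\mathbf{n}(\mathbf{y})\cdot(\mathbf{y}-\mathbf{x})}{4\pi|\mathbf{x}-\mathbf{y}|^3}f(\mathbf{x})\,dS(\mathbf{x})$, written in modified form. The factor $s$ arises from replacing the Green's function $G(\mathbf{x})=-\frac{1}{4\pi|\mathbf{x}|}$ by $G_\delta(\mathbf{x})=G(\mathbf{x})\operatorname{erf}(|\mathbf{x}|/\delta)$, for which $\nabla G_\delta(\mathbf{x})=\nabla G(\mathbf{x})\,s(|\mathbf{x}|/\delta)$. *)

theory Defs
  imports "HOL-Analysis.Analysis" "HOL-Library.Landau_Symbols"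
begin

section \<open>Smooth maps\<close>

text \<open>On an open set, this says that all iterated directional derivatives up to order
  \<open>k\<close> exist and are continuous.\<close>

fun Ck_on :: "nat \<Rightarrow> 'a set \<Rightarrow> ('a::real_normed_vector \<Rightarrow> 'b::real_normed_vector) \<Rightarrow> bool" where
  "Ck_on 0 U f \<longleftrightarrow> continuous_on U f"
| "Ck_on (Suc k) U f \<longleftrightarrow>
     (\<forall>x\<in>U. f differentiable (at x)) \<and> (\<forall>v. Ck_on k U (\<lambda>x. frechet_derivative f (at x) v))"

definition smooth_on :: "'a set \<Rightarrow> ('a::real_normed_vector \<Rightarrow> 'b::real_normed_vector) \<Rightarrow> bool" where
  "smooth_on U f \<longleftrightarrow> (\<forall>k. Ck_on k U f)"

text \<open>Smoothness of a function that matters only on a (not necessarily open) set \<open>S\<close>: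
  locally it is the restriction of a smooth function on an open set of the ambient space.\<close>

definition smooth_on_subset :: "'a set \<Rightarrow> ('a::real_normed_vector \<Rightarrow> 'b::real_normed_vector) \<Rightarrow> bool" where
  "smooth_on_subset S f \<longleftrightarrow>
     (\<forall>p\<in>S. \<exists>U g. open U \<and> p \<in> U \<and> smooth_on U g \<and> (\<forall>x\<in>S \<inter> U. f x = g x))"

section \<open>Bounded domains with smooth boundary\<close>

text \<open>Near each boundary point the set is, after a rigid change of coordinates, the part of a
  ball that lies above the graph of a smooth function.\<close>

definition smooth_boundary :: "(real^3) set \<Rightarrow> bool" where
  "smooth_boundary \<Omega> \<longleftrightarrow>
     (\<forall>p\<in>frontier \<Omega>. \<exists>r (T :: real^3 \<Rightarrow> real^3) (\<gamma> :: real^2 \<Rightarrow> real).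
        r > 0 \<and> orthogonal_transformation T \<and> smooth_on UNIV \<gamma> \<and>
        \<Omega> \<inter> ball p r = {x \<in> ball p r. T x $ 3 > \<gamma> (vector [T x $ 1, T x $ 2])})"

definition smooth_bounded_domain :: "(real^3) set \<Rightarrow> bool" where
  "smooth_bounded_domain \<Omega> \<longleftrightarrow>
     \<Omega> \<noteq> {} \<and> open \<Omega> \<and> connected \<Omega> \<and> bounded \<Omega> \<and> smooth_boundary \<Omega>"

text \<open>A unit vector orthogonal to the velocity at \<open>x\<close> of every curve that runs in the boundary,
  and pointing out of \<open>\<Omega>\<close>.\<close>

definition outward_unit_normal :: "(real^3) set \<Rightarrow> real^3 \<Rightarrow> real^3 \<Rightarrow> bool" where
  "outward_unit_normal \<Omega> x \<nu> \<longleftrightarrow>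
     norm \<nu> = 1 \<and>
     (\<forall>c w. c 0 = x \<and> (\<forall>\<^sub>F t in nhds (0::real). c t \<in> frontier \<Omega>) \<and>
        (c has_vector_derivative w) (at 0) \<longrightarrow> \<nu> \<bullet> w = 0) \<and>
     (\<forall>\<^sub>F t in at_right (0::real). x + t *\<^sub>R \<nu> \<notin> closure \<Omega>)"

section \<open>Surface measure\<close>

definition area_element :: "(real^2 \<Rightarrow> real^3) \<Rightarrow> real^2 \<Rightarrow> real" where
  "area_element \<phi> u =
     norm (cross3 (frechet_derivative \<phi> (at u) (axis 1 1)) (frechet_derivative \<phi> (at u) (axis 2 1)))"

definition regular_parametrization :: "(real^3) set \<Rightarrow> (real^2) set \<Rightarrow> (real^2 \<Rightarrow> real^3) \<Rightarrow> bool" where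
  "regular_parametrization S U \<phi> \<longleftrightarrow>
     open U \<and> smooth_on U \<phi> \<and> (\<forall>u\<in>U. area_element \<phi> u \<noteq> 0) \<and>
     openin (top_of_set S) (\<phi> ` U) \<and> (\<exists>\<psi>. homeomorphism U (\<phi> ` U) \<phi> \<psi>)"

text \<open>The area measure of the piece \<open>\<phi> ` U\<close>: a Borel set \<open>A\<close> receives the integral of the area
  element over \<open>{u \<in> U. \<phi> u \<in> A}\<close>.\<close>

definition patch_measure :: "(real^2) set \<Rightarrow> (real^2 \<Rightarrow> real^3) \<Rightarrow> (real^3) measure" where
  "patch_measure U \<phi> =
     distr (density (restrict_space lborel U) (\<lambda>u. ennreal (area_element \<phi> u))) borel \<phi>"

text \<open>The surface measure \<open>dS\<close> is the Borel measure, vanishing off \<open>S\<close>, that agrees with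
  \<open>patch_measure U \<phi>\<close> on the Borel subsets of \<open>\<phi> ` U\<close> for each regular parametrization.  For a
  smooth surface the patch measures agree on overlaps by the change of variables formula, so the
  glued measure is their least upper bound in the complete lattice of Borel measures.\<close>

definition surface_measure :: "(real^3) set \<Rightarrow> (real^3) measure" where
  "surface_measure S = Sup {patch_measure U \<phi> | U \<phi>. regular_parametrization S U \<phi>}"

section \<open>The adjoint double layer potential and its regularization\<close>

definition erf :: "real \<Rightarrow> real" where
  "erf \<rho> = 2 / sqrt pi * (LBINT t=0..\<rho>. exp (- (t\<^sup>2)))"

definition s_factor :: "real \<Rightarrow> real" where
  "s_factor \<rho> = erf \<rho> - 2 / sqrt pi * \<rho> * exp (- (\<rho>\<^sup>2))"

text \<open>At \<open>x = y\<close> the integrands take the value \<open>0\<close> (division by zero), on a set of measure zero.\<close>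

definition adjoint_double_layer ::
    "(real^3) set \<Rightarrow> (real^3 \<Rightarrow> real^3) \<Rightarrow> (real^3 \<Rightarrow> real) \<Rightarrow> real^3 \<Rightarrow> real" where
  "adjoint_double_layer S n f y =
     (LINT x:S|surface_measure S.
        ((f x *\<^sub>R n y + f y *\<^sub>R n x) \<bullet> (y - x)) / (4 * pi * norm (x - y) ^ 3)) + 1/2 * f y"

definition adjoint_double_layer_reg ::
    "real \<Rightarrow> (real^3) set \<Rightarrow> (real^3 \<Rightarrow> real^3) \<Rightarrow> (real^3 \<Rightarrow> real) \<Rightarrow> real^3 \<Rightarrow> real" where
  "adjoint_double_layer_reg \<delta> S n f y =
     (LINT x:S|surface_measure S.
        ((f x *\<^sub>R n y + f y *\<^sub>R n x) \<bullet> (y - x)) * s_factor (norm (x - y) / \<delta>)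
          / (4 * pi * norm (x - y) ^ 3)) + 1/2 * f y"

end

theory Submission
  imports Defs "HOL-Probability.Sinc_Integral"
begin

text \<open>The regularized kernel differs from the singular one by the factor \<open>s(r/\<delta>) - 1\<close>, which decays
  rapidly in \<open>r/\<delta>\<close>, so only a neighbourhood of \<open>y\<close> of size about \<open>\<delta>\<close> matters. There the surface is the
  graph of a smooth function \<open>\<gamma>\<close> over a plane, \<open>y\<close> lying over \<open>u\<close>. With
  \<open>K w = \<gamma> (u + w) - \<gamma> u - D\<gamma>(u) w\<close> and with \<open>H\<close> the density \<open>f\<close> times the area element, normalized
  at \<open>u\<close>, the numerator times the area element equals
  \<open>(H w - H 0) K w - H 0 (D\<gamma>(u + w) w - D\<gamma>(u) w - 2 K w)\<close> (\<open>numerator_chart\<close>). The combination of the two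
  normals is made so that the quadratic part of the surface drops out of the last bracket: it is an odd cubic
  form in \<open>w\<close> up to fourth order. The same holds for the first product, hence for the whole numerator
  (\<open>numerator_cancellation\<close>).

  Consequently the numerator is \<open>O(r^3)\<close>, so both integrands are bounded and the singular integral converges
  absolutely. Averaging the error integrand over \<open>w\<close> and \<open>-w\<close> removes the odd cubic part; what remains is
  bounded by a multiple of \<open>|w| / (1 + (|w|/\<delta>)^2)^3\<close>, whose integral over the plane scales like \<open>\<delta>^3\<close>
  (\<open>regularization_error_near\<close>, \<open>decay_integral_bound\<close>). The chart need not be adapted to the tangent
  plane at \<open>y\<close>: distances at \<open>w\<close> and \<open>-w\<close> then differ by \<open>O(|w|^2)\<close>, which is harmless because it meets the
  derivative of the kernel, \<open>O(r^-4)\<close>, and the cubic numerator.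

  To evaluate the integral, the surface measure, a supremum of patch measures, has to be identified with the
  area measure of one graph chart (\<open>emeasure_surface_measure\<close>). For this it is enough that every other
  parametrization gives at most the measure of the chart. As the inverse of a graph chart is a linear projection, the
  transition map into the chart is differentiable without appeal to the inverse function theorem, and the
  change of variables formula applies (\<open>patch_measure_le_chart\<close>).\<close>

section \<open>The regularizing factor\<close>

lemma le_one_plus_square:
  fixes t :: real
  shows "t \<le> 1 + t\<^sup>2"
proof -
  have "0 \<le> (t - 1/2)\<^sup>2" by simp
  then show ?thesis by (simp add: power2_eq_square algebra_simps)
qed

lemma erf_has_derivative:
  "(erf has_real_derivative 2 / sqrt pi * exp (- (\<rho>\<^sup>2))) (at \<rho>)"
proof -
  let ?g = "\<lambda>u::real. LBINT t=ereal 0..ereal u. exp (- (t\<^sup>2))"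
  let ?a = "- \<bar>\<rho>\<bar> - 1" and ?b = "\<bar>\<rho>\<bar> + 1"
  have "(?g has_vector_derivative exp (- (\<rho>\<^sup>2))) (at \<rho> within {?a..?b})"
    by (rule interval_integral_FTC2) (auto intro!: continuous_intros)
  moreover have "at \<rho> within {?a..?b} = at \<rho>"
    by (rule at_within_interior) auto
  ultimately have "(?g has_real_derivative exp (- (\<rho>\<^sup>2))) (at \<rho>)"
    by (simp add: has_real_derivative_iff_has_vector_derivative)
  from DERIV_cmult[OF this, of "2 / sqrt pi"] show ?thesis
    by (simp add: erf_def[abs_def] zero_ereal_def)
qed

lemma erf_tendsto_1: "(erf \<longlongrightarrow> 1) at_top"
proof -
  let ?e = "\<lambda>t::real. exp (- (t\<^sup>2))"
  have "has_bochner_integral lborel (\<lambda>x. indicator {0..} x *\<^sub>R ?e x) (sqrt pi / 2)"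
    by (rule gaussian_moment_0)
  then have int: "set_integrable lborel {0..} ?e" and val: "(LINT x:{0..}|lborel. ?e x) = sqrt pi / 2"
    by (auto simp: has_bochner_integral_iff set_integrable_def set_lebesgue_integral_def)
  have "((\<lambda>b. LINT x:{0..b}|lborel. ?e x) \<longlongrightarrow> (LINT x:{0..}|lborel. ?e x)) at_top"
    by (rule tendsto_set_lebesgue_integral_at_top[OF _ int]) simp
  then have "((\<lambda>b. 2 / sqrt pi * (LINT x:{0..b}|lborel. ?e x)) \<longlongrightarrow> 2 / sqrt pi * (sqrt pi / 2)) at_top"
    unfolding val by (rule tendsto_mult_left)
  moreover have "\<forall>\<^sub>F b in at_top. 2 / sqrt pi * (LINT x:{0..b}|lborel. ?e x) = erf b"
    using eventually_ge_at_top[of 0]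
    by eventually_elim (simp add: erf_def interval_integral_Icc zero_ereal_def)
  ultimately show ?thesis by (simp add: Lim_transform_eventually)
qed

lemma s_factor_has_derivative:
  "(s_factor has_real_derivative 4 / sqrt pi * \<rho>\<^sup>2 * exp (- (\<rho>\<^sup>2))) (at \<rho>)"
  unfolding s_factor_def[abs_def]
  by (rule derivative_eq_intros erf_has_derivative refl)+
     (simp add: field_simps power2_eq_square)

lemma isCont_s_factor: "isCont s_factor \<rho>"
  using s_factor_has_derivative DERIV_isCont by blast

lemma s_factor_tendsto_1: "(s_factor \<longlongrightarrow> 1) at_top"
proof -
  have "((\<lambda>\<rho>::real. 2 / sqrt pi * \<rho> * exp (- (\<rho>\<^sup>2))) \<longlongrightarrow> 0) at_top"
    by real_asymp
  from tendsto_diff[OF erf_tendsto_1 this] show ?thesis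
    by (simp add: s_factor_def[abs_def])
qed

text \<open>A single term of the exponential series at \<open>1 + x\<close>.\<close>

lemma exp_minus_le_power:
  fixes x :: real
  assumes "0 \<le> x"
  shows "exp (- x) \<le> exp 1 * fact n / (1 + x) ^ n"
proof -
  have "(1 + x) ^ n / fact n \<le> exp (1 + x)"
    unfolding exp_def using sum_le_suminf[OF summable_exp_generic[of "1+x"], of "{n}"] assms
    by (simp add: divide_inverse mult.commute)
  then show ?thesis using assms
    by (simp add: exp_add exp_minus field_simps)
qed

text \<open>Since \<open>s' = 4/\<surd>\<pi> \<rho>\<^sup>2 exp (-\<rho>\<^sup>2) \<ge> 0\<close> and \<open>s \<rightarrow> 1\<close>, \<open>s\<close> is at most \<open>1\<close>. The
  decay follows because \<open>A/(1+\<rho>\<^sup>2)^3 - (1 - s)\<close> tends to \<open>0\<close> and, for large \<open>A\<close>, is nonincreasing. The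
  power \<open>3\<close> makes the final bound integrable over the plane.\<close>

lemma one_minus_s_factor_bounds:
  obtains A where "A > 0" "\<And>\<rho>. \<rho> \<ge> 0 \<Longrightarrow> 0 \<le> 1 - s_factor \<rho>"
    "\<And>\<rho>. \<rho> \<ge> 0 \<Longrightarrow> 1 - s_factor \<rho> \<le> A / (1 + \<rho>\<^sup>2) ^ 3"
proof -
  \<comment> \<open>this is a bound for \<open>4/\<surd>\<pi> t exp (-t\<^sup>2) (1+t\<^sup>2)^4\<close>\<close>
  define A where "A = (4 / sqrt pi) * (exp 1 * fact 5)"
  have "A > 0" by (simp add: A_def)
  have 0: "0 \<le> 1 - s_factor \<rho>" if "\<rho> \<ge> 0" for \<rho>
  proof -
    have "\<forall>\<^sub>F r in at_top. s_factor \<rho> \<le> s_factor r"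
      using eventually_ge_at_top[of \<rho>]
    proof eventually_elim
      case (elim r)
      then show ?case
        by (rule DERIV_nonneg_imp_nondecreasing) (use s_factor_has_derivative in force)
    qed
    then have "s_factor \<rho> \<le> 1"
      using tendsto_lowerbound[OF s_factor_tendsto_1] by simp
    then show ?thesis by simp
  qed
  have 1: "1 - s_factor \<rho> \<le> A / (1 + \<rho>\<^sup>2) ^ 3" if "\<rho> \<ge> 0" for \<rho>
  proof -
    let ?D = "\<lambda>\<rho>. A / (1 + \<rho>\<^sup>2) ^ 3 - (1 - s_factor \<rho>)"
    have "?D r \<le> ?D \<rho>" if "\<rho> \<le> r" for r
    using that proof (rule DERIV_nonpos_imp_nonincreasing)
      fix t assume "\<rho> \<le> t" "t \<le> r"
      then have t: "t \<ge> 0" using \<open>\<rho> \<ge> 0\<close> by simp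
      have pos: "1 + t\<^sup>2 > 0" by (simp add: add_pos_nonneg)
      let ?d = "- 6 * A * t / (1 + t\<^sup>2) ^ 4 + 4 / sqrt pi * t\<^sup>2 * exp (- (t\<^sup>2))"
      have e: "1 + t\<^sup>2 \<noteq> 0" using pos by simp
      have "(?D has_real_derivative ?d) (at t)"
      proof -
        have p: "((\<lambda>\<rho>. (1 + \<rho>\<^sup>2) ^ 3) has_real_derivative 3 * (1 + t\<^sup>2)\<^sup>2 * (2 * t)) (at t)"
          by (rule derivative_eq_intros refl | simp)+
        have frac: "(0 * z ^ 3 - A * (3 * z\<^sup>2 * (2 * t))) / (z ^ 3 * z ^ 3) = - 6 * A * t / z ^ 4"
          if "z \<noteq> 0" for z :: real
          using that by (simp add: field_simps eval_nat_numeral)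
        have "((\<lambda>\<rho>. A / (1 + \<rho>\<^sup>2) ^ 3) has_real_derivative - 6 * A * t / (1 + t\<^sup>2) ^ 4) (at t)"
          using DERIV_divide[OF DERIV_const[of A] p] e frac[OF e] by simp
        from DERIV_diff[OF this DERIV_diff[OF DERIV_const[of 1] s_factor_has_derivative]]
        show ?thesis by simp
      qed
      moreover have "?d \<le> 0"
      proof -
        have "4 / sqrt pi * t * exp (- (t\<^sup>2)) \<le> 4 / sqrt pi * (1 + t\<^sup>2) * (exp 1 * fact 5 / (1 + t\<^sup>2) ^ 5)"
        proof (intro mult_mono)
          show "t \<le> 1 + t\<^sup>2" by (rule le_one_plus_square)
        qed (use exp_minus_le_power[of "t\<^sup>2" 5] t in auto)
        also have "\<dots> = A / (1 + t\<^sup>2) ^ 4" using e by (simp add: A_def divide_simps eval_nat_numeral) (simp add: algebra_simps)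
        also have "\<dots> \<le> 6 * A / (1 + t\<^sup>2) ^ 4"
          using \<open>A > 0\<close> pos by (simp add: divide_right_mono)
        finally have "4 / sqrt pi * t * exp (- (t\<^sup>2)) * t \<le> 6 * A / (1 + t\<^sup>2) ^ 4 * t"
          using t mult_right_mono by blast
        then show ?thesis by (simp add: power2_eq_square mult_ac)
      qed
      ultimately show "\<exists>y. (?D has_real_derivative y) (at t) \<and> y \<le> 0" by blast
    qed
    then have "\<forall>\<^sub>F r in at_top. ?D r \<le> ?D \<rho>"
      by (rule eventually_mono[OF eventually_ge_at_top[of \<rho>]])
    moreover have "((\<lambda>\<rho>::real. 1 / (1 + \<rho>\<^sup>2) ^ 3) \<longlongrightarrow> 0) at_top"
      by real_asymp
    from tendsto_diff[OF tendsto_mult_left[OF this, of A] tendsto_diff[OF tendsto_const[of 1] s_factor_tendsto_1]]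
    have "(?D \<longlongrightarrow> 0) at_top" by simp
    ultimately have "0 \<le> ?D \<rho>"
      by (intro tendsto_upperbound[of ?D 0 at_top]) auto
    then show ?thesis by simp
  qed
  show thesis using \<open>A > 0\<close> 0 1 that by blast
qed

text \<open>The second bound is the mean value theorem. Both depend only on a lower bound \<open>d\<close> of the distances:
  near \<open>y\<close> this will be the length of the parameter vector, which is the same at \<open>w\<close> and \<open>- w\<close>.\<close>

lemma regularized_kernel_bounds:
  obtains B where "B > 0"
    "\<And>\<delta> d r. \<lbrakk>0 < \<delta>; 0 < d; d \<le> r\<rbrakk> \<Longrightarrow>
        \<bar>(s_factor (r / \<delta>) - 1) / r ^ 3\<bar> \<le> B / (1 + (d / \<delta>)\<^sup>2) ^ 3 / d ^ 3"
    "\<And>\<delta> d r r'. \<lbrakk>0 < \<delta>; 0 < d; d \<le> r; d \<le> r'\<rbrakk> \<Longrightarrow>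
        \<bar>(s_factor (r / \<delta>) - 1) / r ^ 3 - (s_factor (r' / \<delta>) - 1) / r' ^ 3\<bar>
          \<le> \<bar>r - r'\<bar> * (B / (1 + (d / \<delta>)\<^sup>2) ^ 3 / d ^ 4)"
proof -
  obtain A where A: "A > 0" and s0: "\<And>\<rho>. \<rho> \<ge> 0 \<Longrightarrow> 0 \<le> 1 - s_factor \<rho>"
    and s1: "\<And>\<rho>. \<rho> \<ge> 0 \<Longrightarrow> 1 - s_factor \<rho> \<le> A / (1 + \<rho>\<^sup>2) ^ 3"
    using one_minus_s_factor_bounds by blast
  define B where "B = 3 * A + 4 / sqrt pi * (exp 1 * fact 5)"
  have B: "B > 0" "A \<le> B" using A by (auto simp: B_def add_pos_nonneg)
  have decay: "c / (1 + (r / \<delta>)\<^sup>2) ^ 3 / r ^ k \<le> c / (1 + (d / \<delta>)\<^sup>2) ^ 3 / d ^ k"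
    if "0 < \<delta>" "0 < d" "d \<le> r" "0 \<le> c" for \<delta> d r c :: real and k
  proof -
    have "d / \<delta> \<le> r / \<delta>" using that by (simp add: divide_right_mono)
    then have "(1 + (d / \<delta>)\<^sup>2) ^ 3 \<le> (1 + (r / \<delta>)\<^sup>2) ^ 3"
      by (intro power_mono add_left_mono) (use that in auto)
    moreover have "d ^ k \<le> r ^ k" by (intro power_mono) (use that in auto)
    ultimately show ?thesis
      by (intro frac_le) (use that in \<open>auto intro!: zero_less_power add_pos_nonneg\<close>)
  qed
  show thesis
  proof (rule that[of B])
    fix \<delta> d r :: real assume *: "0 < \<delta>" "0 < d" "d \<le> r"
    have "\<bar>(s_factor (r / \<delta>) - 1) / r ^ 3\<bar> = (1 - s_factor (r / \<delta>)) / r ^ 3"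
      using s0[of "r / \<delta>"] * by (simp add: abs_if field_simps)
    also have "\<dots> \<le> A / (1 + (r / \<delta>)\<^sup>2) ^ 3 / r ^ 3"
      using s1[of "r / \<delta>"] * by (intro divide_right_mono) auto
    also have "\<dots> \<le> B / (1 + (r / \<delta>)\<^sup>2) ^ 3 / r ^ 3"
      using * B by (intro divide_right_mono) auto
    also have "\<dots> \<le> B / (1 + (d / \<delta>)\<^sup>2) ^ 3 / d ^ 3"
      using decay[of \<delta> d r B 3] * B by simp
    finally show "\<bar>(s_factor (r / \<delta>) - 1) / r ^ 3\<bar> \<le> B / (1 + (d / \<delta>)\<^sup>2) ^ 3 / d ^ 3" .
  next
    fix \<delta> d r r' :: real assume *: "0 < \<delta>" "0 < d" "d \<le> r" "d \<le> r'"
    let ?G = "\<lambda>r. (s_factor (r / \<delta>) - 1) / r ^ 3"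
    let ?G' = "\<lambda>r. (4 / sqrt pi * (r / \<delta>) ^ 3 * exp (- ((r / \<delta>)\<^sup>2)) + 3 * (1 - s_factor (r / \<delta>))) / r ^ 4"
    have der: "(?G has_field_derivative ?G' x) (at x within {d..})" if "x \<in> {d..}" for x
    proof -
      have x: "x > 0" using that * by simp
      have "((\<lambda>r. s_factor (r / \<delta>)) has_real_derivative
              (4 / sqrt pi * (x / \<delta>)\<^sup>2 * exp (- ((x / \<delta>)\<^sup>2))) * (1 / \<delta>)) (at x)"
        by (rule DERIV_chain2[OF s_factor_has_derivative])
           (rule derivative_eq_intros refl | use * in simp)+
      note d1 = DERIV_diff[OF this DERIV_const[of 1]]
      have quotient: "(c * q\<^sup>2 * e * (q / x) * x ^ 3 - (\<sigma> - 1) * (3 * x\<^sup>2)) / (x ^ 3 * x ^ 3)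
            = (c * q ^ 3 * e + 3 * (1 - \<sigma>)) / x ^ 4" for c e q \<sigma> :: real
      proof -
        have 1: "c * q\<^sup>2 * e * (q / x) * x ^ 3 - (\<sigma> - 1) * (3 * x\<^sup>2) = x\<^sup>2 * (c * q ^ 3 * e + 3 * (1 - \<sigma>))"
          using x by (simp add: power2_eq_square power3_eq_cube algebra_simps)
        have 2: "x ^ 3 * x ^ 3 = x\<^sup>2 * x ^ 4" by (simp flip: power_add)
        show ?thesis unfolding 1 2 by (rule mult_divide_mult_cancel_left) (use x in simp)
      qed
      have "1 / \<delta> = x / \<delta> / x" using x by simp
      then have "(?G has_real_derivative
          (4 / sqrt pi * (x / \<delta>)\<^sup>2 * exp (- ((x / \<delta>)\<^sup>2)) * (x / \<delta> / x) * x ^ 3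
            - (s_factor (x / \<delta>) - 1) * (3 * x\<^sup>2)) / (x ^ 3 * x ^ 3)) (at x)"
        using DERIV_divide[OF d1 DERIV_pow[of 3]] x by simp
      then have "(?G has_real_derivative ?G' x) (at x)"
        unfolding quotient .
      then show ?thesis by (rule has_field_derivative_at_within)
    qed
    have bd: "norm (?G' x) \<le> B / (1 + (d / \<delta>)\<^sup>2) ^ 3 / d ^ 4" if "x \<in> {d..}" for x
    proof -
      have x: "x > 0" using that * by simp
      define q where "q = x / \<delta>"
      have q: "q \<ge> 0" using x * by (simp add: q_def)
      have pos: "1 + q\<^sup>2 > 0" by (simp add: add_pos_nonneg)
      have "q ^ 3 \<le> (1 + q\<^sup>2) ^ 2"
      proof -
        have "q \<le> 1 + q\<^sup>2" by (rule le_one_plus_square)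
        then have "q * q\<^sup>2 \<le> (1 + q\<^sup>2) * (1 + q\<^sup>2)" by (intro mult_mono) (use q in auto)
        then show ?thesis by (simp add: eval_nat_numeral)
      qed
      then have "q ^ 3 * exp (- (q\<^sup>2)) \<le> (1 + q\<^sup>2) ^ 2 * (exp 1 * fact 5 / (1 + q\<^sup>2) ^ 5)"
        by (intro mult_mono) (use exp_minus_le_power[of "q\<^sup>2" 5] q in auto)
      also have "\<dots> = exp 1 * fact 5 / (1 + q\<^sup>2) ^ 3"
        using pos by (simp add: divide_simps eval_nat_numeral)
      finally have "4 / sqrt pi * (q ^ 3 * exp (- (q\<^sup>2))) \<le> 4 / sqrt pi * (exp 1 * fact 5 / (1 + q\<^sup>2) ^ 3)"
        by (intro mult_left_mono) auto
      with s1[OF q] have "4 / sqrt pi * q ^ 3 * exp (- (q\<^sup>2)) + 3 * (1 - s_factor q) \<le> B / (1 + q\<^sup>2) ^ 3"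
        by (simp add: B_def add_divide_distrib)
      moreover have "0 \<le> 4 / sqrt pi * q ^ 3 * exp (- (q\<^sup>2)) + 3 * (1 - s_factor q)"
        using s0[OF q] q by (intro add_nonneg_nonneg) auto
      ultimately have "norm (?G' x) \<le> B / (1 + q\<^sup>2) ^ 3 / x ^ 4"
        unfolding q_def[symmetric] real_norm_def abs_divide
        using x by (simp only: abs_of_nonneg zero_le_power less_imp_le divide_right_mono)
      also have "\<dots> \<le> B / (1 + (d / \<delta>)\<^sup>2) ^ 3 / d ^ 4"
        using decay[of \<delta> d x B 4] * B that by (simp add: q_def)
      finally show ?thesis .
    qed
    have "norm (?G r - ?G r') \<le> B / (1 + (d / \<delta>)\<^sup>2) ^ 3 / d ^ 4 * norm (r - r')"
      by (rule field_differentiable_bound[OF _ der bd]) (use * in auto)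
    then show "\<bar>?G r - ?G r'\<bar> \<le> \<bar>r - r'\<bar> * (B / (1 + (d / \<delta>)\<^sup>2) ^ 3 / d ^ 4)"
      by (simp add: mult.commute)
  qed (fact B)
qed

section \<open>Iterated directional derivatives\<close>

text \<open>The smoothness predicate speaks of derivatives along fixed vectors. Iterating along one and the same
  vector \<open>v\<close> yields the Taylor coefficients along the ray in direction \<open>v\<close>, as homogeneous functions of \<open>v\<close>.\<close>

definition dir_deriv :: "'a::real_normed_vector \<Rightarrow> ('a \<Rightarrow> 'b::real_normed_vector) \<Rightarrow> 'a \<Rightarrow> 'b" where
  "dir_deriv v g = (\<lambda>x. frechet_derivative g (at x) v)"

lemma Ck_on_mono: "Ck_on k U f \<Longrightarrow> V \<subseteq> U \<Longrightarrow> Ck_on k V f"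
  by (induction k arbitrary: f) (auto intro: continuous_on_subset)

lemma smooth_on_mono: "smooth_on U f \<Longrightarrow> V \<subseteq> U \<Longrightarrow> smooth_on V f"
  by (auto simp: smooth_on_def intro: Ck_on_mono)

lemma smooth_on_differentiable: "smooth_on U f \<Longrightarrow> x \<in> U \<Longrightarrow> f differentiable (at x)"
  unfolding smooth_on_def by (metis Ck_on.simps(2))

lemma smooth_on_has_derivative:
  "smooth_on U f \<Longrightarrow> x \<in> U \<Longrightarrow> (f has_derivative (\<lambda>v. dir_deriv v f x)) (at x)"
  using smooth_on_differentiable frechet_derivative_works unfolding dir_deriv_def by fastforce

lemma smooth_on_dir_deriv: "smooth_on U f \<Longrightarrow> smooth_on U (dir_deriv v f)"
  unfolding smooth_on_def dir_deriv_def by (metis Ck_on.simps(2))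

lemma smooth_on_imp_continuous_on: "smooth_on U f \<Longrightarrow> continuous_on U f"
  unfolding smooth_on_def by (metis Ck_on.simps(1))

lemma smooth_on_iter_dir_deriv: "smooth_on U f \<Longrightarrow> smooth_on U ((dir_deriv v ^^ j) f)"
  by (induction j) (auto intro: smooth_on_dir_deriv)

lemma linear_dir_deriv:
  assumes "smooth_on U f" "x \<in> U"
  shows "linear (\<lambda>v. dir_deriv v f x)"
  using smooth_on_has_derivative[OF assms] has_derivative_linear by blast

lemma dir_deriv_eqI: "(f has_derivative f') (at x) \<Longrightarrow> dir_deriv v f x = f' v"
  unfolding dir_deriv_def by (metis frechet_derivative_at)

lemma iter_dir_deriv_cong:
  assumes "open U" "smooth_on U g" "\<And>x. x \<in> U \<Longrightarrow> h x = g x" "x \<in> U"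
  shows "(dir_deriv v ^^ j) h x = (dir_deriv v ^^ j) g x"
  using assms(4)
proof (induction j arbitrary: x)
  case 0
  then show ?case using assms(3) by simp
next
  case (Suc j)
  have "(((dir_deriv v ^^ j) g) has_derivative (\<lambda>w. dir_deriv w ((dir_deriv v ^^ j) g) x)) (at x)"
    using smooth_on_has_derivative smooth_on_iter_dir_deriv assms(2) Suc.prems by blast
  then have "(((dir_deriv v ^^ j) h) has_derivative (\<lambda>w. dir_deriv w ((dir_deriv v ^^ j) g) x)) (at x)"
    using has_derivative_transform_within_open[OF _ assms(1) Suc.prems] Suc.IH by fastforce
  then show ?case by (simp add: dir_deriv_eqI)
qed

lemma iter_dir_deriv_sum:
  fixes h :: "'b \<Rightarrow> 'a::real_normed_vector \<Rightarrow> real"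
  assumes "open U" "\<And>b. b \<in> B \<Longrightarrow> smooth_on U (h b)" "x \<in> U"
  shows "(dir_deriv v ^^ j) (\<lambda>x. \<Sum>b\<in>B. c b * h b x) x = (\<Sum>b\<in>B. c b * (dir_deriv v ^^ j) (h b) x)"
  using assms(3)
proof (induction j arbitrary: x)
  case (Suc j)
  have "((\<lambda>x. \<Sum>b\<in>B. c b * (dir_deriv v ^^ j) (h b) x) has_derivative
      (\<lambda>w. \<Sum>b\<in>B. c b * dir_deriv w ((dir_deriv v ^^ j) (h b)) x)) (at x)"
    by (intro has_derivative_sum has_derivative_mult_right smooth_on_has_derivative[where U=U]
          smooth_on_iter_dir_deriv assms(2) Suc.prems)
  then have "(((dir_deriv v ^^ j) (\<lambda>x. \<Sum>b\<in>B. c b * h b x)) has_derivative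
      (\<lambda>w. \<Sum>b\<in>B. c b * dir_deriv w ((dir_deriv v ^^ j) (h b)) x)) (at x)"
    using has_derivative_transform_within_open[OF _ assms(1) Suc.prems] Suc.IH by fastforce
  then show ?case by (simp add: dir_deriv_eqI)
qed simp

lemma iter_dir_deriv_scale:
  fixes g :: "'a::real_normed_vector \<Rightarrow> real"
  assumes "open U" "smooth_on U g" "x \<in> U"
  shows "(dir_deriv (c *\<^sub>R v) ^^ j) g x = c ^ j * (dir_deriv v ^^ j) g x"
  using assms(3)
proof (induction j arbitrary: x)
  case (Suc j)
  have "((\<lambda>x. c ^ j * (dir_deriv v ^^ j) g x) has_derivative
      (\<lambda>w. c ^ j * dir_deriv w ((dir_deriv v ^^ j) g) x)) (at x)"
    by (intro has_derivative_mult_right smooth_on_has_derivative[where U=U]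
          smooth_on_iter_dir_deriv assms(2) Suc.prems)
  then have "(((dir_deriv (c *\<^sub>R v) ^^ j) g) has_derivative
      (\<lambda>w. c ^ j * dir_deriv w ((dir_deriv v ^^ j) g) x)) (at x)"
    using has_derivative_transform_within_open[OF _ assms(1) Suc.prems] Suc.IH by fastforce
  moreover have "dir_deriv (c *\<^sub>R v) ((dir_deriv v ^^ j) g) x = c * dir_deriv v ((dir_deriv v ^^ j) g) x"
    using linear_scale[OF linear_dir_deriv[OF smooth_on_iter_dir_deriv[OF assms(2)] Suc.prems]] by simp
  ultimately show ?case by (simp add: dir_deriv_eqI)
qed simp

text \<open>Uniformity in the direction \<open>w\<close> does not come from compactness of the sphere but from linearity:
  one derivative along \<open>w\<close> is a combination of derivatives along basis vectors with coefficients at most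
  \<open>norm w\<close>, and smoothness passes to each of these.\<close>

lemma iter_dir_deriv_bound:
  fixes g :: "'a::euclidean_space \<Rightarrow> real"
  assumes "open U" "compact K" "K \<subseteq> U" "smooth_on U g"
  shows "\<exists>M. \<forall>w. \<forall>x\<in>K. \<bar>(dir_deriv w ^^ j) g x\<bar> \<le> M * norm w ^ j"
  using assms(4)
proof (induction j arbitrary: g)
  case 0
  have "bounded (g ` K)"
    using smooth_on_imp_continuous_on[OF 0] assms(2,3)
    by (meson compact_continuous_image compact_imp_bounded continuous_on_subset)
  then show ?case by (auto simp: bounded_iff)
next
  case (Suc j)
  have "\<exists>M. \<forall>b\<in>Basis. \<forall>w. \<forall>x\<in>K. \<bar>(dir_deriv w ^^ j) (dir_deriv b g) x\<bar> \<le> M b * norm w ^ j"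
    using Suc.IH[OF smooth_on_dir_deriv[OF Suc.prems]] by meson
  then obtain M where M: "\<And>b w x. b \<in> Basis \<Longrightarrow> x \<in> K \<Longrightarrow>
      \<bar>(dir_deriv w ^^ j) (dir_deriv b g) x\<bar> \<le> M b * norm w ^ j" by blast
  have "\<bar>(dir_deriv w ^^ Suc j) g x\<bar> \<le> (\<Sum>b\<in>Basis. M b) * norm w ^ Suc j" if x: "x \<in> K" for w x
  proof -
    have eq: "dir_deriv w g x = (\<Sum>b\<in>Basis. (w \<bullet> b) * dir_deriv b g x)" if "x \<in> U" for x
    proof -
      have "dir_deriv (\<Sum>b\<in>Basis. (w \<bullet> b) *\<^sub>R b) g x = (\<Sum>b\<in>Basis. (w \<bullet> b) * dir_deriv b g x)"
        by (simp add: linear_sum[OF linear_dir_deriv[OF Suc.prems that]]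
            linear_scale[OF linear_dir_deriv[OF Suc.prems that]])
      then show ?thesis by (simp add: euclidean_representation)
    qed
    have "(dir_deriv w ^^ Suc j) g x = (dir_deriv w ^^ j) (dir_deriv w g) x"
      by (simp add: funpow_swap1)
    also have "\<dots> = (dir_deriv w ^^ j) (\<lambda>x. \<Sum>b\<in>Basis. (w \<bullet> b) * dir_deriv b g x) x"
      using iter_dir_deriv_cong[OF assms(1) smooth_on_dir_deriv[OF Suc.prems] eq[symmetric]] x assms(3) by auto
    also have "\<dots> = (\<Sum>b\<in>Basis. (w \<bullet> b) * (dir_deriv w ^^ j) (dir_deriv b g) x)"
      by (rule iter_dir_deriv_sum[OF assms(1)]) (use smooth_on_dir_deriv Suc.prems x assms(3) in auto)
    also have "\<bar>\<dots>\<bar> \<le> (\<Sum>b\<in>Basis. norm w * (M b * norm w ^ j))"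
      by (rule order_trans[OF sum_abs], rule sum_mono)
         (auto simp: abs_mult intro!: mult_mono M[OF _ x] Basis_le_norm)
    finally show ?thesis by (simp add: sum_distrib_left sum_distrib_right mult_ac)
  qed
  then show ?case by blast
qed

text \<open>Taylor's formula on the segment from \<open>u\<close> to \<open>u + w\<close>, with a remainder uniform in the direction.
  The case \<open>j = 1\<close> expands the derivative at \<open>u + w\<close> in the same coefficients as the function itself.\<close>

lemma taylor_iter_dir_deriv:
  fixes g :: "'a::euclidean_space \<Rightarrow> real"
  assumes "open U" "smooth_on U g" "u \<in> U" "0 < n"
  shows "(\<lambda>w. (dir_deriv w ^^ j) g (u + w) - (\<Sum>m<n. (dir_deriv w ^^ (m + j)) g u / fact m))
           \<in> O[nhds 0](\<lambda>w. norm w ^ (n + j))"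
proof -
  obtain R where R: "R > 0" "cball u R \<subseteq> U" using assms(1,3) open_contains_cball by blast
  obtain M where M: "\<And>w x. x \<in> cball u R \<Longrightarrow> \<bar>(dir_deriv w ^^ (n + j)) g x\<bar> \<le> M * norm w ^ (n + j)"
    using iter_dir_deriv_bound[OF assms(1) compact_cball R(2) assms(2)] by meson
  have "\<bar>(dir_deriv w ^^ j) g (u + w) - (\<Sum>m<n. (dir_deriv w ^^ (m + j)) g u / fact m)\<bar>
      \<le> M * norm w ^ (n + j)" if w: "norm w < R" for w
  proof -
    let ?d = "\<lambda>m t. (dir_deriv w ^^ (m + j)) g (u + t *\<^sub>R w)"
    have inK: "u + t *\<^sub>R w \<in> cball u R" if "0 \<le> t" "t \<le> 1" for t
    proof -
      have "\<bar>t\<bar> * norm w \<le> 1 * norm w" by (rule mult_right_mono) (use that in auto)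
      then show ?thesis using w by (simp add: dist_norm)
    qed
    have der: "DERIV (?d m) t :> ?d (Suc m) t" if t: "0 \<le> t" "t \<le> 1" for m t
    proof -
      have "u + t *\<^sub>R w \<in> U" using inK[OF t] R by blast
      note D = smooth_on_has_derivative[OF smooth_on_iter_dir_deriv[OF assms(2), where v=w and j="m + j"] this]
      have "((\<lambda>t. u + t *\<^sub>R w) has_derivative (\<lambda>s. s *\<^sub>R w)) (at t)"
        by (auto intro!: derivative_eq_intros)
      from has_derivative_compose[OF this D]
      have "(?d m has_derivative (\<lambda>s. dir_deriv (s *\<^sub>R w) ((dir_deriv w ^^ (m + j)) g) (u + t *\<^sub>R w))) (at t)" .
      moreover have "dir_deriv (s *\<^sub>R w) ((dir_deriv w ^^ (m + j)) g) (u + t *\<^sub>R w) = ?d (Suc m) t * s" for s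
        using linear_scale[OF linear_dir_deriv[OF smooth_on_iter_dir_deriv[OF assms(2)] \<open>u + t *\<^sub>R w \<in> U\<close>]]
        by simp
      ultimately show ?thesis by (simp add: has_field_derivative_def)
    qed
    have "\<exists>t. 0 < t \<and> t < 1 \<and> ?d 0 1 = (\<Sum>m<n. ?d m 0 / fact m * 1 ^ m) + ?d n t / fact n * 1 ^ n"
      by (rule Maclaurin) (use der assms(4) in auto)
    then obtain t where t: "0 < t" "t < 1" and
      eq: "?d 0 1 = (\<Sum>m<n. ?d m 0 / fact m) + ?d n t / fact n" by auto
    have "\<bar>?d n t / fact n\<bar> \<le> \<bar>?d n t\<bar>"
      by (simp add: divide_le_eq abs_mult mult_le_cancel_left1)
    also have "\<dots> \<le> M * norm w ^ (n + j)"
      using M[OF inK] t by simp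
    finally show ?thesis using eq by simp
  qed
  then show ?thesis
    by (intro bigoI[of _ M]) (auto simp: eventually_nhds_metric dist_norm intro!: exI[of _ R] R)
qed

lemma iter_dir_deriv_bigo:
  fixes g :: "'a::euclidean_space \<Rightarrow> real"
  assumes "open U" "smooth_on U g" "u \<in> U"
  shows "(\<lambda>w. (dir_deriv w ^^ j) g u) \<in> O[F](\<lambda>w. norm w ^ j)"
proof -
  obtain M where M: "\<And>w x. x \<in> {u} \<Longrightarrow> \<bar>(dir_deriv w ^^ j) g x\<bar> \<le> M * norm w ^ j"
    using iter_dir_deriv_bound[OF assms(1) _ _ assms(2), of "{u}"] assms(3) by auto
  then show ?thesis by (intro bigoI[of _ M]) auto
qed

section \<open>Even and odd parts of expansions at a point\<close>

definition quad_rem :: "('a::real_normed_vector \<Rightarrow> real) \<Rightarrow> 'a \<Rightarrow> 'a \<Rightarrow> real" where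
  "quad_rem g u w = g (u + w) - g u - dir_deriv w g u"

text \<open>Let \<open>a m\<close> be the \<open>m\<close>-th directional derivative at \<open>u\<close>. As \<open>quad_rem\<close> is \<open>a 2 / 2 + a 3 / 6 + ...\<close>
  and the increment of the derivative is \<open>a 2 + a 3 / 2 + ...\<close>, this difference has no quadratic term.\<close>

definition double_layer_defect :: "('a::real_normed_vector \<Rightarrow> real) \<Rightarrow> 'a \<Rightarrow> 'a \<Rightarrow> real" where
  "double_layer_defect g u w = dir_deriv w g (u + w) - dir_deriv w g u - 2 * quad_rem g u w"

text \<open>The filter is the full neighbourhood filter, so these bounds also force the value \<open>0\<close> at the origin
  when \<open>k > 0\<close>. Integrands are therefore controlled at the singular point as well.\<close>

abbreviation bigo_norm :: "('a::real_normed_vector \<Rightarrow> real) \<Rightarrow> nat \<Rightarrow> bool" where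
  "bigo_norm f k \<equiv> f \<in> O[nhds 0](\<lambda>w. norm w ^ k)"

lemma bigo_norm_reflect:
  assumes "bigo_norm f k"
  shows "bigo_norm (\<lambda>w. f (- w)) k"
proof -
  have "filterlim uminus (nhds (0::'a)) (nhds 0)"
    by (rule tendsto_eq_intros refl filterlim_ident | simp)+
  from landau_o.big.compose[OF assms this] show ?thesis by (simp add: o_def)
qed

lemma bigo_norm_mult:
  assumes "bigo_norm f j" "bigo_norm g k" "m = j + k"
  shows "bigo_norm (\<lambda>w. f w * g w) m"
  using landau_o.big.mult[OF assms(1,2)] by (simp add: assms(3) power_add)

lemma bigo_norm_weaken:
  assumes "bigo_norm f k" "j \<le> k"
  shows "bigo_norm f j"
proof -
  have "(\<lambda>w::'a. norm w ^ k) \<in> O[nhds 0](\<lambda>w. norm w ^ j)"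
  proof (rule bigoI[of _ 1])
    have "\<forall>\<^sub>F w in nhds 0. norm (w::'a) < 1"
      unfolding eventually_nhds_metric by (rule exI[of _ 1]) auto
    then show "\<forall>\<^sub>F w in nhds 0. norm (norm (w::'a) ^ k) \<le> 1 * norm (norm w ^ j)"
      by eventually_elim (simp add: power_decreasing[OF assms(2)])
  qed
  with assms(1) show ?thesis by (rule landau_o.big_trans)
qed

lemma bigo_normE:
  assumes "bigo_norm g k"
  obtains C where "C > 0" "\<forall>\<^sub>F w in nhds 0. \<bar>g w\<bar> \<le> C * norm w ^ k"
  using landau_o.bigE[OF assms] that by auto

lemma dir_deriv_odd:
  assumes "smooth_on UNIV (g :: 'a::euclidean_space \<Rightarrow> real)"
  shows "(dir_deriv (- w) ^^ j) g u = (-1) ^ j * (dir_deriv w ^^ j) g u"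
  using iter_dir_deriv_scale[OF open_UNIV assms, where x = u and c = "-1" and v = w and j = j] by simp

text \<open>The quadratic Taylor term is even and cancels in the difference.\<close>

lemma quad_rem_expansion:
  fixes g :: "'a::euclidean_space \<Rightarrow> real"
  assumes "smooth_on UNIV g"
  shows "bigo_norm (quad_rem g u) 2"
    and "bigo_norm (\<lambda>w. quad_rem g u (- w) - quad_rem g u w) 3"
proof -
  have "bigo_norm (\<lambda>w. (dir_deriv w ^^ 0) g (u + w) - (\<Sum>m<2. (dir_deriv w ^^ (m + 0)) g u / fact m)) (2 + 0)"
    by (rule taylor_iter_dir_deriv[OF open_UNIV assms]) auto
  then show "bigo_norm (quad_rem g u) 2"
    by (simp add: quad_rem_def[abs_def] eval_nat_numeral algebra_simps)
  let ?r = "\<lambda>w. (dir_deriv w ^^ 0) g (u + w) - (\<Sum>m<3. (dir_deriv w ^^ (m + 0)) g u / fact m)"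
  have r: "bigo_norm ?r (3 + 0)"
    by (rule taylor_iter_dir_deriv[OF open_UNIV assms]) auto
  have "?r (- w) - ?r w = quad_rem g u (- w) - quad_rem g u w" for w
    using dir_deriv_odd[OF assms, of 1 w u] dir_deriv_odd[OF assms, of 2 w u]
    by (simp add: quad_rem_def eval_nat_numeral algebra_simps)
  then show "bigo_norm (\<lambda>w. quad_rem g u (- w) - quad_rem g u w) 3"
    using sum_in_bigo(2)[OF bigo_norm_reflect[OF r] r] by simp
qed

text \<open>The leading term is one sixth of the third directional derivative, which is odd in the direction.\<close>

lemma double_layer_defect_expansion:
  fixes g :: "'a::euclidean_space \<Rightarrow> real"
  assumes "smooth_on UNIV g"
  shows "bigo_norm (double_layer_defect g u) 3"
    and "bigo_norm (\<lambda>w. double_layer_defect g u w + double_layer_defect g u (- w)) 4"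
proof -
  let ?c = "\<lambda>w. (dir_deriv w ^^ 3) g u / 6"
  define r where "r w = (dir_deriv w ^^ 0) g (u + w) - (\<Sum>m<4. (dir_deriv w ^^ (m + 0)) g u / fact m)" for w
  define s where "s w = (dir_deriv w ^^ 1) g (u + w) - (\<Sum>m<3. (dir_deriv w ^^ (m + 1)) g u / fact m)" for w
  have "bigo_norm r (4 + 0)" "bigo_norm s (3 + 1)"
    unfolding r_def s_def by (rule taylor_iter_dir_deriv[OF open_UNIV assms]; simp)+
  then have rs: "bigo_norm (\<lambda>w. s w - 2 * r w) 4"
    by (intro sum_in_bigo(2)) auto
  have E: "double_layer_defect g u w = (s w - 2 * r w) + ?c w" for w
    by (simp add: r_def s_def double_layer_defect_def quad_rem_def eval_nat_numeral algebra_simps)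
  have c: "bigo_norm ?c 3"
    using iter_dir_deriv_bigo[OF open_UNIV assms, where j = 3 and u = u] by simp
  show "bigo_norm (double_layer_defect g u) 3"
    using sum_in_bigo(1)[OF bigo_norm_weaken[OF rs, of 3] c] unfolding E[symmetric] by simp
  have "?c (- w) = - ?c w" for w
    using dir_deriv_odd[OF assms, of 3 w u] by simp
  then have "double_layer_defect g u w + double_layer_defect g u (- w)
      = (s w - 2 * r w) + (s (- w) - 2 * r (- w))" for w
    unfolding E by simp
  then show "bigo_norm (\<lambda>w. double_layer_defect g u w + double_layer_defect g u (- w)) 4"
    using sum_in_bigo(1)[OF rs bigo_norm_reflect[OF rs]] by simp
qed

text \<open>A weakening of having a first-order Taylor expansion at \<open>0\<close> that names no linear form: the even part of
  \<open>h - h 0\<close> is of second order. This is what the cancellation uses.\<close>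

definition affine_at_0 :: "('a::real_normed_vector \<Rightarrow> real) \<Rightarrow> bool" where
  "affine_at_0 h \<longleftrightarrow> bigo_norm (\<lambda>w. h w - h 0) 1 \<and> bigo_norm (\<lambda>w. h w + h (- w) - 2 * h 0) 2"

lemma affine_at_0_const: "affine_at_0 (\<lambda>w. c)"
  by (simp add: affine_at_0_def)

lemma affine_at_0_add:
  assumes "affine_at_0 g" "affine_at_0 h"
  shows "affine_at_0 (\<lambda>w. g w + h w)"
proof -
  have "bigo_norm (\<lambda>w. (g w - g 0) + (h w - h 0)) 1"
       "bigo_norm (\<lambda>w. (g w + g (- w) - 2 * g 0) + (h w + h (- w) - 2 * h 0)) 2"
    using assms unfolding affine_at_0_def by (auto intro: sum_in_bigo)
  then show ?thesis unfolding affine_at_0_def by (simp add: algebra_simps)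
qed

lemma affine_at_0_mult:
  assumes "affine_at_0 g" "affine_at_0 h"
  shows "affine_at_0 (\<lambda>w. g w * h w)"
proof -
  define a b where "a = (\<lambda>w. g w - g 0)" and "b = (\<lambda>w. h w - h 0)"
  have a: "bigo_norm a 1" and b: "bigo_norm b 1"
    and a2: "bigo_norm (\<lambda>w. a w + a (- w)) 2" and b2: "bigo_norm (\<lambda>w. b w + b (- w)) 2"
    using assms by (simp_all add: affine_at_0_def a_def b_def algebra_simps)
  have ab: "bigo_norm (\<lambda>w. a w * b w) 2"
    by (rule bigo_norm_mult[OF a b]) simp
  have "bigo_norm (\<lambda>w. g 0 * b w + h 0 * a w + a w * b w) 1"
    using bigo_norm_weaken[OF ab, of 1] a b by (intro sum_in_bigo(1)) auto
  moreover have "bigo_norm (\<lambda>w. g 0 * (b w + b (- w)) + h 0 * (a w + a (- w)) + (a w * b w + a (- w) * b (- w))) 2"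
    using bigo_norm_reflect[OF ab] ab a2 b2 by (intro sum_in_bigo(1)) auto
  ultimately show ?thesis
    by (simp add: affine_at_0_def a_def b_def algebra_simps)
qed

text \<open>With \<open>a = h - h 0\<close> and \<open>b = sqrt h - sqrt (h 0)\<close> one has \<open>2 sqrt (h 0) b = a - b\<^sup>2\<close>, so the even part
  of \<open>b\<close> is inherited from that of \<open>a\<close> up to the second-order term \<open>b\<^sup>2\<close>.\<close>

lemma affine_at_0_sqrt:
  assumes "affine_at_0 h" "\<And>w. h w \<ge> 1"
  shows "affine_at_0 (\<lambda>w. sqrt (h w))"
proof -
  let ?a = "\<lambda>w. h w - h 0" and ?q = "\<lambda>w. sqrt (h w)"
  have a: "bigo_norm ?a 1" and a2: "bigo_norm (\<lambda>w. ?a w + ?a (- w)) 2"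
    using assms(1) by (simp_all add: affine_at_0_def algebra_simps)
  have q1: "?q w \<ge> 1" for w using assms(2) by simp
  have sq: "?a w = (?q w - ?q 0) * (?q w + ?q 0)" for w
    using assms(2)[of w] assms(2)[of 0] by (simp add: algebra_simps flip: power2_eq_square)
  have le: "\<bar>?q w - ?q 0\<bar> \<le> \<bar>?a w\<bar>" for w
  proof -
    have "\<bar>?q w - ?q 0\<bar> * 1 \<le> \<bar>?q w - ?q 0\<bar> * (?q w + ?q 0)"
    proof (rule mult_left_mono)
      show "1 \<le> ?q w + ?q 0" using q1[of w] q1[of 0] by linarith
    qed simp
    then show ?thesis using q1[of w] q1[of 0] by (simp add: sq abs_mult)
  qed
  then have b: "bigo_norm (\<lambda>w. ?q w - ?q 0) 1"
    by (intro landau_o.big_trans[OF bigoI[of _ 1] a]) auto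
  have bb: "bigo_norm (\<lambda>w. (?q w - ?q 0) * (?q w - ?q 0)) 2"
    by (rule bigo_norm_mult[OF b b]) simp
  have eq: "?q w - ?q 0 = (?a w - (?q w - ?q 0) * (?q w - ?q 0)) / (2 * ?q 0)" for w
    using q1[of 0] by (simp add: sq field_simps)
  have "bigo_norm (\<lambda>w. (?a w + ?a (- w) - ((?q w - ?q 0) * (?q w - ?q 0)
      + (?q (- w) - ?q 0) * (?q (- w) - ?q 0))) / (2 * ?q 0)) 2"
    using sum_in_bigo(2)[OF a2 sum_in_bigo(1)[OF bb bigo_norm_reflect[OF bb]]] q1[of 0] by simp
  moreover have "?q w + ?q (- w) - 2 * ?q 0 = (?a w + ?a (- w) - ((?q w - ?q 0) * (?q w - ?q 0)
      + (?q (- w) - ?q 0) * (?q (- w) - ?q 0))) / (2 * ?q 0)" for w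
    using eq[of w] eq[of "- w"] by (simp add: add_divide_distrib diff_divide_distrib)
  ultimately show ?thesis using b by (simp add: affine_at_0_def)
qed

lemma affine_at_0_smooth:
  fixes g :: "'a::euclidean_space \<Rightarrow> real"
  assumes "smooth_on UNIV g"
  shows "affine_at_0 (\<lambda>w. g (u + w))"
proof -
  note q = quad_rem_expansion(1)[OF assms, of u]
  have d: "bigo_norm (\<lambda>w. dir_deriv w g u) 1"
    using iter_dir_deriv_bigo[OF open_UNIV assms, where j = 1 and u = u] by simp
  have "bigo_norm (\<lambda>w. quad_rem g u w + dir_deriv w g u) 1"
    by (rule sum_in_bigo(1)[OF bigo_norm_weaken[OF q] d]) simp
  moreover have even: "quad_rem g u w + quad_rem g u (- w) = g (u + w) + g (u + - w) - 2 * g u" for w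
    using dir_deriv_odd[OF assms, of 1 w u] by (simp add: quad_rem_def)
  have "bigo_norm (\<lambda>w. g (u + w) + g (u + - w) - 2 * g u) 2"
    using sum_in_bigo(1)[OF q bigo_norm_reflect[OF q]] unfolding even .
  ultimately show ?thesis by (simp add: affine_at_0_def quad_rem_def)
qed

text \<open>The linear part of \<open>F\<close> at \<open>p\<close> applied to \<open>z w + z (- w)\<close> is small because this sum is.\<close>

lemma affine_at_0_compose:
  fixes F :: "'b::euclidean_space \<Rightarrow> real" and z :: "'a::real_normed_vector \<Rightarrow> 'b"
  assumes U: "open U" "p \<in> U" and F: "smooth_on U F"
    and z1: "bigo_norm (\<lambda>w. norm (z w)) 1" and z2: "bigo_norm (\<lambda>w. norm (z w + z (- w))) 2"
    and z0: "z 0 = 0" and eq: "\<And>w. h w = F (p + z w)"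
  shows "affine_at_0 h"
proof -
  let ?r = "\<lambda>v. F (p + v) - F p - dir_deriv v F p"
  obtain M where M: "\<And>v. \<bar>dir_deriv v F p\<bar> \<le> M * norm v"
    using iter_dir_deriv_bound[OF U(1) _ _ F, where K = "{p}" and j = 1] U(2) by auto
  have "bigo_norm (\<lambda>w. (dir_deriv w ^^ 0) F (p + w) - (\<Sum>m<2. (dir_deriv w ^^ (m + 0)) F p / fact m)) (2 + 0)"
    by (rule taylor_iter_dir_deriv[OF U(1) F U(2)]) auto
  then have r: "bigo_norm ?r 2" by (simp add: eval_nat_numeral algebra_simps)
  obtain c where "c > 0" and c: "\<forall>\<^sub>F w in nhds 0. norm (norm (z w)) \<le> c * norm (norm w ^ 1)"
    using landau_o.bigE[OF z1] by blast
  have "(z \<longlongrightarrow> 0) (nhds 0)"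
  proof (rule Lim_null_comparison)
    show "\<forall>\<^sub>F w in nhds 0. norm (z w) \<le> c * norm w" using c by simp
    show "((\<lambda>w::'a. c * norm w) \<longlongrightarrow> 0) (nhds 0)"
      by (rule tendsto_eq_intros refl filterlim_ident | simp)+
  qed
  from landau_o.big.compose[OF r this]
  have rz: "(\<lambda>w. ?r (z w)) \<in> O[nhds 0](\<lambda>w. norm (z w) ^ 2)" .
  also have "(\<lambda>w. norm (z w) ^ 2) \<in> O[nhds 0](\<lambda>w. norm w ^ 2)"
    using bigo_norm_mult[OF z1 z1, of 2] by (simp add: power2_eq_square)
  finally have rz: "bigo_norm (\<lambda>w. ?r (z w)) 2" .
  have d: "(\<lambda>w. dir_deriv (v w) F p) \<in> O[nhds 0](\<lambda>w. norm (v w))" for v :: "'a \<Rightarrow> 'b"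
    by (rule bigoI[of _ M]) (simp add: M)
  have "bigo_norm (\<lambda>w. ?r (z w) + dir_deriv (z w) F p) 1"
    by (rule sum_in_bigo(1)[OF bigo_norm_weaken[OF rz] landau_o.big_trans[OF d z1]]) simp
  moreover have "bigo_norm (\<lambda>w. (?r (z w) + ?r (z (- w))) + dir_deriv (z w + z (- w)) F p) 2"
    by (rule sum_in_bigo(1)[OF sum_in_bigo(1)[OF rz bigo_norm_reflect[OF rz]] landau_o.big_trans[OF d z2]])
  moreover have "dir_deriv (z w + z (- w)) F p = dir_deriv (z w) F p + dir_deriv (z (- w)) F p" for w
    using linear_add[OF linear_dir_deriv[OF F U(2)]] .
  ultimately show ?thesis by (simp add: affine_at_0_def eq z0 algebra_simps)
qed

text \<open>The even part of \<open>(H w - H 0) * K w\<close> splits into (second order) times \<open>K\<close> and (first order) times the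
  odd part of \<open>K\<close>; both are of fourth order.\<close>

lemma numerator_cancellation:
  fixes H K E :: "'a::real_normed_vector \<Rightarrow> real"
  assumes H: "affine_at_0 H"
    and K: "bigo_norm K 2" "bigo_norm (\<lambda>w. K (- w) - K w) 3"
    and E: "bigo_norm E 3" "bigo_norm (\<lambda>w. E w + E (- w)) 4"
    and N: "\<And>w. N w = (H w - H 0) * K w - H 0 * E w"
  shows "bigo_norm N 3" "bigo_norm (\<lambda>w. N w + N (- w)) 4"
proof -
  have h1: "bigo_norm (\<lambda>w. H w - H 0) 1" and h2: "bigo_norm (\<lambda>w. H w + H (- w) - 2 * H 0) 2"
    using H by (simp_all add: affine_at_0_def)
  have "bigo_norm (\<lambda>w. (H w - H 0) * K w - H 0 * E w) 3"
    using bigo_norm_mult[OF h1 K(1), of 3] E(1) by (intro sum_in_bigo(2)) auto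
  then show "bigo_norm N 3" unfolding N[symmetric] by simp
  have "bigo_norm (\<lambda>w. (H w + H (- w) - 2 * H 0) * K w + (H (- w) - H 0) * (K (- w) - K w)
      - H 0 * (E w + E (- w))) 4"
    using bigo_norm_mult[OF h2 K(1), of 4] bigo_norm_mult[OF bigo_norm_reflect[OF h1] K(2), of 4] E(2)
    by (intro sum_in_bigo) auto
  then show "bigo_norm (\<lambda>w. N w + N (- w)) 4" by (simp add: N algebra_simps)
qed

section \<open>Patch measures and their supremum\<close>

lemma sets_Sup_borel:
  fixes P :: "'a::topological_space measure set"
  assumes "P \<noteq> {}" "\<And>M. M \<in> P \<Longrightarrow> sets M = sets borel"
  shows "sets (Sup P) = sets borel"
proof -
  have sp: "\<And>M. M \<in> P \<Longrightarrow> space M = UNIV"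
    using sets_eq_imp_space_eq[OF assms(2)] by simp
  have "(\<Union>M\<in>P. sets M) = sets (borel :: 'a measure)"
    using assms by (intro SUP_eq_const) auto
  then have "sets (Sup P) = sigma_sets UNIV (sets (borel :: 'a measure))"
    using sets_Sup_eq[of P UNIV, OF sp assms(1)] by (simp only:)
  also have "\<dots> = sets borel"
    using sets.sigma_sets_eq[of "borel :: 'a measure"] by (simp only: space_borel)
  finally show ?thesis .
qed

text \<open>The supremum is bounded above by the measure that equals \<open>M0\<close> inside \<open>Q\<close> and the supremum itself
  outside \<open>Q\<close>; domination inside \<open>Q\<close> makes this an upper bound of the whole family.\<close>

lemma emeasure_Sup_dominated:
  fixes P :: "'a::topological_space measure set"
  assumes M0: "M0 \<in> P" and borel: "\<And>M. M \<in> P \<Longrightarrow> sets M = sets borel"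
    and Q: "Q \<in> sets borel"
    and dom: "\<And>M A. M \<in> P \<Longrightarrow> A \<in> sets borel \<Longrightarrow> A \<subseteq> Q \<Longrightarrow> emeasure M A \<le> emeasure M0 A"
    and A: "A \<in> sets borel" "A \<subseteq> Q"
  shows "emeasure (Sup P) A = emeasure M0 A"
proof (rule antisym)
  have sets_Sup: "sets (Sup P) = sets borel" using sets_Sup_borel M0 borel by blast
  have le_Sup: "emeasure M B \<le> emeasure (Sup P) B" if "M \<in> P" for M B
    using le_measureD3[OF Sup_upper[OF that]] borel[OF that] sets_Sup by simp
  then show "emeasure M0 A \<le> emeasure (Sup P) A" using M0 by blast
  let ?f = "\<lambda>B. emeasure M0 (B \<inter> Q) + emeasure (Sup P) (B - Q)"
  define N where "N = measure_of UNIV (sets borel) ?f"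
  have sets_N: "sets N = sets borel"
    unfolding N_def by (metis sets.sets_measure_of_eq space_borel)
  have em: "emeasure N B = ?f B" if "B \<in> sets borel" for B
    unfolding N_def
  proof (rule emeasure_measure_of_sigma[OF _ _ _ that])
    show "sigma_algebra UNIV (sets (borel :: 'a measure))"
      by (metis sets.sigma_algebra_axioms space_borel)
    show "positive (sets borel) ?f" by (simp add: positive_def)
    show "countably_additive (sets borel) ?f"
    proof (rule countably_additiveI)
      fix F :: "nat \<Rightarrow> 'a set"
      assume F: "range F \<subseteq> sets borel" "disjoint_family F" "\<Union> (range F) \<in> sets borel"
      have "(\<Sum>i. emeasure M0 (F i \<inter> Q)) = emeasure M0 (\<Union>i. F i \<inter> Q)"
        using F Q borel[OF M0]
        by (intro suminf_emeasure) (auto simp: disjoint_family_on_def)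
      moreover have "(\<Sum>i. emeasure (Sup P) (F i - Q)) = emeasure (Sup P) (\<Union>i. F i - Q)"
        using F Q sets_Sup
        by (intro suminf_emeasure) (auto simp: disjoint_family_on_def)
      moreover have "(\<Union>i. F i \<inter> Q) = \<Union> (range F) \<inter> Q" "(\<Union>i. F i - Q) = \<Union> (range F) - Q" by auto
      moreover have "(\<Sum>i. ?f (F i)) = (\<Sum>i. emeasure M0 (F i \<inter> Q)) + (\<Sum>i. emeasure (Sup P) (F i - Q))"
        by (rule suminf_add[symmetric]) auto
      ultimately show "(\<Sum>i. ?f (F i)) = ?f (\<Union> (range F))" by simp
    qed
  qed
  have "M \<le> N" if "M \<in> P" for M
  proof (rule le_measure[THEN iffD2])
    show "sets M = sets N" using borel[OF that] sets_N by simp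
    show "\<forall>B\<in>sets M. emeasure M B \<le> emeasure N B"
    proof
      fix B assume "B \<in> sets M"
      then have B: "B \<in> sets borel" using borel[OF that] by simp
      have "emeasure M B = emeasure M (B \<inter> Q) + emeasure M (B - Q)"
        using B Q borel[OF that] by (subst plus_emeasure) (auto simp: Int_Diff_Un)
      also have "\<dots> \<le> ?f B"
        using B Q that by (intro add_mono dom le_Sup) auto
      finally show "emeasure M B \<le> emeasure N B" using em[OF B] by simp
    qed
  qed
  then have "Sup P \<le> N" by (rule Sup_least)
  then have "emeasure (Sup P) A \<le> emeasure N A"
    by (rule le_measureD3) (simp add: sets_Sup sets_N)
  also have "\<dots> = emeasure M0 A"
    using em[OF A(1)] A(2) by (simp add: Int_absorb2 Diff_eq_empty_iff[THEN iffD2])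
  finally show "emeasure (Sup P) A \<le> emeasure M0 A" .
qed

lemma nn_integral_change_of_variables:
  fixes g :: "real^2 \<Rightarrow> real^2" and h :: "real^2 \<Rightarrow> real"
  assumes W: "W \<in> sets lebesgue" and der: "\<And>v. v \<in> W \<Longrightarrow> (g has_derivative g' v) (at v)"
    and inj: "inj_on g W" and im: "g ` W \<in> sets lebesgue" "g ` W \<subseteq> cbox a b"
    and h: "continuous_on (cbox a b) h" "\<And>u. 0 \<le> h u"
  shows "(\<integral>\<^sup>+v. ennreal (\<bar>det (matrix (g' v))\<bar> * h (g v)) * indicator W v \<partial>lborel)
       = (\<integral>\<^sup>+u. ennreal (h u) * indicator (g ` W) u \<partial>lborel)"
proof -
  let ?f = "\<lambda>u. vec (h u) :: real^1"
  let ?F = "\<lambda>v. \<bar>det (matrix (g' v))\<bar> * h (g v)"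
  have "h absolutely_integrable_on cbox a b"
    using h(1) by (rule absolutely_integrable_continuous)
  then have hi: "h absolutely_integrable_on g ` W"
    unfolding absolutely_integrable_on_def[symmetric]
    using set_integrable_subset[OF _ im] by blast
  define I where "I = integral (g ` W) h"
  \<comment> \<open>the change of variables theorem concerns vector-valued integrands, hence the detour through \<open>real^1\<close>\<close>
  have "?f absolutely_integrable_on g ` W \<and> integral (g ` W) ?f = vec I"
    using hi by (simp add: I_def absolutely_integrable_on_1_iff integral_on_1_eq)
  then have "(\<lambda>v. \<bar>det (matrix (g' v))\<bar> *\<^sub>R ?f (g v)) absolutely_integrable_on W \<and>
      integral W (\<lambda>v. \<bar>det (matrix (g' v))\<bar> *\<^sub>R ?f (g v)) = vec I"
    by (subst has_absolute_integral_change_of_variables[OF W has_derivative_at_withinI[OF der] inj])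
  then have "?F absolutely_integrable_on W" "integral W ?F = I"
    by (simp_all add: absolutely_integrable_on_1_iff integral_on_1_eq vec_eq_iff)
  then have F: "(?F has_integral I) W"
    using has_integral_iff set_lebesgue_integral_eq_integral(1) by blast
  have H: "(h has_integral I) (g ` W)"
    using hi has_integral_iff set_lebesgue_integral_eq_integral(1) unfolding I_def by blast
  show ?thesis
    using nn_integral_has_integral_lebesgue'[OF _ F] nn_integral_has_integral_lebesgue'[OF _ H] h(2)
    by simp
qed

lemma area_element_eq:
  "area_element \<phi> u = norm (cross3 (dir_deriv (axis 1 1) \<phi> u) (dir_deriv (axis 2 1) \<phi> u))"
  by (simp add: area_element_def dir_deriv_def)

lemma continuous_on_area_element: "smooth_on U \<phi> \<Longrightarrow> continuous_on U (area_element \<phi>)"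
  unfolding area_element_eq[abs_def]
  by (intro continuous_intros continuous_on_cross smooth_on_imp_continuous_on smooth_on_dir_deriv)

lemma sets_patch_measure [simp]: "sets (patch_measure U \<phi>) = sets borel"
  by (simp add: patch_measure_def)

lemma
  assumes "open U" "smooth_on U \<phi>"
  shows measurable_patch: "\<phi> \<in> restrict_space lborel U \<rightarrow>\<^sub>M borel"
    and measurable_area_element: "area_element \<phi> \<in> borel_measurable (restrict_space lborel U)"
proof -
  have "\<phi> \<in> borel_measurable (restrict_space borel U)" "area_element \<phi> \<in> borel_measurable (restrict_space borel U)"
    using assms(2) by (auto intro!: borel_measurable_continuous_on_restrict smooth_on_imp_continuous_on
        continuous_on_area_element)
  then show "\<phi> \<in> restrict_space lborel U \<rightarrow>\<^sub>M borel"
    "area_element \<phi> \<in> borel_measurable (restrict_space lborel U)"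
    by (simp_all add: measurable_def sets_restrict_space space_restrict_space)
qed

lemma emeasure_patch_measure:
  assumes "open U" "smooth_on U \<phi>" "A \<in> sets borel"
  shows "emeasure (patch_measure U \<phi>) A
    = (\<integral>\<^sup>+u. ennreal (area_element \<phi> u) * indicator {u \<in> U. \<phi> u \<in> A} u \<partial>lborel)"
proof -
  let ?R = "restrict_space lborel U"
  have [measurable]: "\<phi> \<in> ?R \<rightarrow>\<^sub>M borel" "area_element \<phi> \<in> borel_measurable ?R"
    using measurable_patch measurable_area_element assms by blast+
  have [measurable]: "A \<in> sets borel" by fact
  have sp: "space ?R = U" by (simp add: space_restrict_space)
  have "emeasure (patch_measure U \<phi>) A
      = emeasure (density ?R (\<lambda>u. ennreal (area_element \<phi> u))) (\<phi> -` A \<inter> space ?R)"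
    unfolding patch_measure_def by (subst emeasure_distr) auto
  also have "\<dots> = (\<integral>\<^sup>+u. ennreal (area_element \<phi> u) * indicator (\<phi> -` A \<inter> space ?R) u \<partial>?R)"
    by (subst emeasure_density) (auto intro!: measurable_sets)
  also have "\<dots> = (\<integral>\<^sup>+u. ennreal (area_element \<phi> u) * indicator (\<phi> -` A \<inter> space ?R) u * indicator U u \<partial>lborel)"
    by (rule nn_integral_restrict_space) (use assms(1) in auto)
  also have "\<dots> = (\<integral>\<^sup>+u. ennreal (area_element \<phi> u) * indicator {u \<in> U. \<phi> u \<in> A} u \<partial>lborel)"
    by (rule nn_integral_cong) (auto simp: sp indicator_def)
  finally show ?thesis .
qed

text \<open>The linear and constant summands are carried along because a
  derivative of a function of this form is again of this form, with zero linear part.\<close>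

lemma Ck_on_graph:
  fixes g :: "'a::real_normed_vector \<Rightarrow> real"
  assumes "Ck_on k UNIV g" "bounded_linear L"
  shows "Ck_on k UNIV (\<lambda>u. L u + c + g u *\<^sub>R e)"
  using assms
proof (induction k arbitrary: g L c)
  case 0
  then have "continuous_on UNIV L" by (intro linear_continuous_on)
  with 0 show ?case by (auto intro!: continuous_on_add continuous_on_scaleR continuous_on_const)
next
  case (Suc k)
  have der: "((\<lambda>u. L u + c + g u *\<^sub>R e) has_derivative
      (\<lambda>v. L v + frechet_derivative g (at x) v *\<^sub>R e)) (at x)" for x
  proof -
    have "(g has_derivative frechet_derivative g (at x)) (at x)"
      using Suc.prems(1) frechet_derivative_works by auto
    moreover have "(L has_derivative L) (at x)"
      by (rule bounded_linear_imp_has_derivative) (rule Suc.prems(2))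
    ultimately show ?thesis by (auto intro!: derivative_eq_intros)
  qed
  have eq: "frechet_derivative (\<lambda>u. L u + c + g u *\<^sub>R e) (at x) v = 0 + L v + frechet_derivative g (at x) v *\<^sub>R e" for x v
    by (simp flip: frechet_derivative_at[OF der])
  have "Ck_on k UNIV (\<lambda>x. 0 + L v + frechet_derivative g (at x) v *\<^sub>R e)" for v
    using Suc.IH[of "\<lambda>x. frechet_derivative g (at x) v" "\<lambda>_. 0" "L v"] Suc.prems(1)
    by (auto simp: bounded_linear_zero)
  then show ?case
    unfolding Ck_on.simps eq using der differentiable_def by blast
qed

section \<open>Graph charts of the boundary\<close>

text \<open>The rigid motion of a boundary chart is kept only through the isometric embedding \<open>emb\<close> of the
  parameter plane, the unit vector \<open>e\<close> orthogonal to it and the orthogonal projection \<open>proj\<close>, so that the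
  arguments below are free of coordinates of space.\<close>

locale graph_chart =
  fixes \<Omega> :: "(real^3) set" and p :: "real^3" and r :: real
    and \<gamma> :: "real^2 \<Rightarrow> real" and emb :: "real^2 \<Rightarrow> real^3" and proj :: "real^3 \<Rightarrow> real^2" and e :: "real^3"
  assumes r_pos: "0 < r"
    and smooth_height: "smooth_on UNIV \<gamma>"
    and linear_emb: "linear emb" and linear_proj: "linear proj"
    and proj_emb [simp]: "proj (emb v) = v" and proj_e [simp]: "proj e = 0"
    and decompose: "emb (proj x) + (x \<bullet> e) *\<^sub>R e = x"
    and inner_emb [simp]: "emb v \<bullet> emb w = v \<bullet> w" and emb_e [simp]: "emb v \<bullet> e = 0" "e \<bullet> emb v = 0"
    and e_e [simp]: "e \<bullet> e = 1"
    and open_region: "open \<Omega>"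
    and region: "\<Omega> \<inter> ball p r = {x \<in> ball p r. \<gamma> (proj x) < x \<bullet> e}"

lemma smooth_boundary_graph_chart:
  assumes "smooth_boundary \<Omega>" "open \<Omega>" "p \<in> frontier \<Omega>"
  obtains r \<gamma> emb proj e where "graph_chart \<Omega> p r \<gamma> emb proj e"
proof -
  obtain r T \<gamma> where r: "r > 0" and T: "orthogonal_transformation (T :: real^3 \<Rightarrow> real^3)"
    and \<gamma>: "smooth_on UNIV (\<gamma> :: real^2 \<Rightarrow> real)"
    and reg: "\<Omega> \<inter> ball p r = {x \<in> ball p r. T x $ 3 > \<gamma> (vector [T x $ 1, T x $ 2])}"
    using assms unfolding smooth_boundary_def by meson
  define emb where "emb v = inv T (vector [v $ 1, v $ 2, 0])" for v :: "real^2"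
  define proj where "proj x = (vector [T x $ 1, T x $ 2] :: real^2)" for x
  define e where "e = inv T (axis 3 1)"
  have Ti: "orthogonal_transformation (inv T)" by (rule orthogonal_transformation_inv[OF T])
  have TTi [simp]: "T (inv T x) = x" "inv T (T x) = x" for x
    using orthogonal_transformation_bij[OF T] by (simp_all add: bij_is_surj bij_is_inj surj_f_inv_f)
  have lin: "linear T" "linear (inv T)" using T Ti by (simp_all add: orthogonal_transformation_linear)
  have inn: "inv T a \<bullet> inv T b = a \<bullet> b" for a b
    using Ti by (simp add: orthogonal_transformation_def)
  have e: "x \<bullet> e = T x $ 3" for x
  proof -
    have "x \<bullet> e = inv T (T x) \<bullet> inv T (axis 3 1)" by (simp add: e_def)
    also have "\<dots> = T x $ 3" by (simp only: inn inner_axis) simp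
    finally show ?thesis .
  qed
  have lin_vec: "linear (\<lambda>v :: real^2. vector [v $ 1, v $ 2, 0] :: real^3)"
    by (rule linearI) (simp_all add: vec_eq_iff forall_3)
  have lin_pr: "linear (\<lambda>v :: real^3. vector [v $ 1, v $ 2] :: real^2)"
    by (rule linearI) (simp_all add: vec_eq_iff forall_2)
  have "graph_chart \<Omega> p r \<gamma> emb proj e"
    unfolding graph_chart_def
  proof (intro conjI allI)
    show "linear emb" using linear_compose[OF lin_vec lin(2)] by (simp add: emb_def[abs_def] o_def)
    show "linear proj" using linear_compose[OF lin(1) lin_pr] by (simp add: proj_def[abs_def] o_def)
    show "proj (emb v) = v" for v by (simp add: proj_def emb_def vec_eq_iff forall_2)
    show "proj e = 0" by (simp add: proj_def e_def vec_eq_iff forall_2 axis_def)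
    show "emb (proj x) + (x \<bullet> e) *\<^sub>R e = x" for x
    proof -
      have "vector [T x $ 1, T x $ 2, 0] + (T x $ 3) *\<^sub>R axis 3 1 = T x"
        by (simp add: vec_eq_iff forall_3 axis_def)
      then have "inv T (vector [T x $ 1, T x $ 2, 0] + (T x $ 3) *\<^sub>R axis 3 1) = inv T (T x)"
        by (simp only:)
      then show ?thesis
        by (simp add: linear_add[OF lin(2)] linear_scale[OF lin(2)] emb_def proj_def e e_def[symmetric])
    qed
    show "emb v \<bullet> emb w = v \<bullet> w" for v w
      unfolding emb_def inn by (simp add: inner_vec_def sum_3 sum_2)
    show "emb v \<bullet> e = 0" "e \<bullet> emb v = 0" for v
      by (simp_all add: e emb_def inner_commute[of e])
    show "e \<bullet> e = 1" unfolding e by (simp add: e_def)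
    show "\<Omega> \<inter> ball p r = {x \<in> ball p r. \<gamma> (proj x) < x \<bullet> e}"
      by (simp add: reg e proj_def)
  qed (fact r \<gamma> assms(2))+
  then show thesis using that by blast
qed

context graph_chart
begin

definition chart :: "real^2 \<Rightarrow> real^3" where
  "chart u = emb u + \<gamma> u *\<^sub>R e"

definition tangent :: "real^2 \<Rightarrow> real^2 \<Rightarrow> real^3" where
  "tangent u v = emb v + dir_deriv v \<gamma> u *\<^sub>R e"

definition grad :: "real^2 \<Rightarrow> real^2" where
  "grad u = (\<Sum>b\<in>Basis. dir_deriv b \<gamma> u *\<^sub>R b)"

definition jac :: "real^2 \<Rightarrow> real" where
  "jac u = sqrt (1 + grad u \<bullet> grad u)"

definition dom :: "(real^2) set" where
  "dom = {u. chart u \<in> ball p r}"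

definition out_normal :: "real^2 \<Rightarrow> real^3" where
  "out_normal u = (emb (grad u) - e) /\<^sub>R jac u"

lemma bounded_linear_emb: "bounded_linear emb" and bounded_linear_proj: "bounded_linear proj"
  using linear_emb linear_proj linear_conv_bounded_linear by auto

lemma linear_height: "linear (\<lambda>v. dir_deriv v \<gamma> u)"
  by (rule linear_dir_deriv[OF smooth_height]) simp

lemma grad_inner: "grad u \<bullet> v = dir_deriv v \<gamma> u" "v \<bullet> grad u = dir_deriv v \<gamma> u"
proof -
  have "dir_deriv (\<Sum>b\<in>Basis. (v \<bullet> b) *\<^sub>R b) \<gamma> u = (\<Sum>b\<in>Basis. (v \<bullet> b) * dir_deriv b \<gamma> u)"
    by (simp add: linear_sum[OF linear_height] linear_scale[OF linear_height])
  then show "v \<bullet> grad u = dir_deriv v \<gamma> u"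
    by (simp add: euclidean_representation grad_def inner_sum_right mult.commute)
  then show "grad u \<bullet> v = dir_deriv v \<gamma> u" by (simp add: inner_commute)
qed

lemma jac_ge_1: "jac u \<ge> 1" by (simp add: jac_def)

lemma jac_sq: "jac u * jac u = 1 + grad u \<bullet> grad u"
  by (simp add: jac_def)

lemma smooth_chart: "smooth_on UNIV chart"
proof -
  have "Ck_on k UNIV (\<lambda>u. emb u + 0 + \<gamma> u *\<^sub>R e)" for k
    by (rule Ck_on_graph[OF _ bounded_linear_emb]) (use smooth_height in \<open>simp add: smooth_on_def\<close>)
  then show ?thesis by (simp add: smooth_on_def chart_def[abs_def])
qed

lemma continuous_chart: "continuous_on A chart"
  using smooth_on_imp_continuous_on[OF smooth_chart] continuous_on_subset by blast

lemma chart_has_derivative: "(chart has_derivative tangent u) (at u)"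
proof -
  have "(\<gamma> has_derivative (\<lambda>v. dir_deriv v \<gamma> u)) (at u)"
    by (rule smooth_on_has_derivative[OF smooth_height]) simp
  then show ?thesis
    unfolding chart_def[abs_def] tangent_def[abs_def]
    by (auto intro!: derivative_eq_intros bounded_linear_imp_has_derivative[OF bounded_linear_emb])
qed

lemma dir_deriv_chart: "dir_deriv v chart u = tangent u v"
  by (rule dir_deriv_eqI[OF chart_has_derivative])

lemma proj_chart [simp]: "proj (chart u) = u"
  by (simp add: chart_def linear_add[OF linear_proj] linear_scale[OF linear_proj])

lemma chart_inner_e [simp]: "chart u \<bullet> e = \<gamma> u"
  by (simp add: chart_def inner_add_left)

lemma chart_proj: "x \<bullet> e = \<gamma> (proj x) \<Longrightarrow> chart (proj x) = x"
  using decompose[of x] by (simp add: chart_def)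

lemma inj_chart: "inj chart"
  by (metis injI proj_chart)

lemma norm_proj_le: "norm (proj x) \<le> norm x"
proof -
  have "x \<bullet> x = (emb (proj x) + (x \<bullet> e) *\<^sub>R e) \<bullet> (emb (proj x) + (x \<bullet> e) *\<^sub>R e)"
    by (simp only: decompose)
  also have "\<dots> = proj x \<bullet> proj x + (x \<bullet> e)\<^sup>2"
    by (simp only: inner_add_left inner_add_right inner_scaleR_left inner_scaleR_right inner_emb emb_e e_e)
       (simp add: power2_eq_square)
  finally have "proj x \<bullet> proj x \<le> x \<bullet> x" by simp
  then show ?thesis by (simp add: norm_le)
qed

lemma open_dom: "open dom"
proof -
  have "open (chart -` ball p r)"
    by (rule open_vimage) (use continuous_chart in auto)
  then show ?thesis by (simp add: dom_def vimage_def)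
qed

lemma dom_bounded: "dom \<subseteq> cball (proj p) r"
proof
  fix u assume "u \<in> dom"
  then have "norm (chart u - p) \<le> r" by (simp add: dom_def dist_norm norm_minus_commute)
  moreover have "u - proj p = proj (chart u - p)" by (simp add: linear_diff[OF linear_proj])
  ultimately have "norm (u - proj p) \<le> r" using norm_proj_le[of "chart u - p"] by simp
  then show "u \<in> cball (proj p) r" by (simp add: dist_norm norm_minus_commute)
qed

lemma region_iff: "x \<in> ball p r \<Longrightarrow> x \<in> \<Omega> \<longleftrightarrow> \<gamma> (proj x) < x \<bullet> e"
  using region by blast

lemma frontier_iff: "x \<in> ball p r \<Longrightarrow> x \<in> frontier \<Omega> \<longleftrightarrow> x \<bullet> e = \<gamma> (proj x)"
proof
  assume x: "x \<in> ball p r"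
  have cont: "continuous_on UNIV (\<lambda>x. x \<bullet> e - \<gamma> (proj x))"
    by (intro continuous_intros continuous_on_compose2[OF smooth_on_imp_continuous_on[OF smooth_height]]
        linear_continuous_on bounded_linear_proj) auto
  {
    assume fr: "x \<in> frontier \<Omega>"
    then have "x \<notin> \<Omega>" using open_region by (simp add: frontier_def interior_open)
    then have le: "x \<bullet> e \<le> \<gamma> (proj x)" using region_iff[OF x] by simp
    show "x \<bullet> e = \<gamma> (proj x)"
    proof (rule ccontr)
      assume "x \<bullet> e \<noteq> \<gamma> (proj x)"
      then have lt: "x \<bullet> e - \<gamma> (proj x) < 0" using le by simp
      let ?V = "ball p r \<inter> (\<lambda>x. x \<bullet> e - \<gamma> (proj x)) -` {..<0}"
      have "open ?V" by (intro open_Int open_ball open_vimage open_lessThan cont)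
      moreover have "x \<in> ?V" using x lt by simp
      moreover have "?V \<inter> \<Omega> = {}" using region_iff by fastforce
      ultimately have "x \<notin> closure \<Omega>" using open_Int_closure_eq_empty by blast
      then show False using fr by (simp add: frontier_def)
    qed
  next
    assume eq: "x \<bullet> e = \<gamma> (proj x)"
    then have "x \<notin> \<Omega>" using region_iff[OF x] by simp
    moreover have "x \<in> closure \<Omega>"
    proof -
      have lim: "((\<lambda>t. x + t *\<^sub>R e) \<longlongrightarrow> x) (at_right 0)"
        by (rule tendsto_eq_intros refl | simp)+
      have ev: "\<forall>\<^sub>F t in at_right 0. x + t *\<^sub>R e \<in> ball p r"
        by (rule topological_tendstoD[OF lim open_ball x])
      have "\<forall>\<^sub>F t in at_right (0::real). t > 0" by (rule eventually_at_right_less)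
      with ev have "\<forall>\<^sub>F t in at_right 0. x + t *\<^sub>R e \<in> \<Omega>"
      proof eventually_elim
        case (elim t)
        then show ?case
          using eq by (simp add: region_iff linear_add[OF linear_proj] linear_scale[OF linear_proj] inner_add_left)
      qed
      then have "\<forall>\<^sub>F t in at_right 0. x + t *\<^sub>R e \<in> closure \<Omega>"
        by eventually_elim (use closure_subset in blast)
      then show ?thesis
        by (rule Lim_in_closed_set[OF closed_closure _ _ lim]) simp
    qed
    ultimately show "x \<in> frontier \<Omega>" using open_region by (simp add: frontier_def interior_open)
  }
qed

lemma chart_dom: "chart ` dom = frontier \<Omega> \<inter> ball p r"
proof safe
  fix u assume "u \<in> dom"
  then show "chart u \<in> frontier \<Omega>" "chart u \<in> ball p r" using frontier_iff[of "chart u"] by (auto simp: dom_def)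
next
  fix x assume x: "x \<in> frontier \<Omega>" "x \<in> ball p r"
  then have "chart (proj x) = x" using frontier_iff chart_proj by blast
  then show "x \<in> chart ` dom" using x unfolding dom_def by (metis (mono_tags) imageI mem_Collect_eq)
qed

lemma area_element_chart: "area_element chart u = jac u"
proof -
  let ?a = "axis 1 1 :: real^2" and ?b = "axis 2 1 :: real^2"
  have B: "(Basis :: (real^2) set) = {?a, ?b}" by (auto simp: Basis_vec_def UNIV_2)
  have ne: "?a \<noteq> ?b" by (simp add: axis_eq_axis)
  have ii: "?a \<bullet> ?a = 1" "?b \<bullet> ?b = 1" "?a \<bullet> ?b = 0" "?b \<bullet> ?a = 0" by (simp_all add: inner_axis_axis)
  have gg: "grad u \<bullet> grad u = (dir_deriv ?a \<gamma> u)\<^sup>2 + (dir_deriv ?b \<gamma> u)\<^sup>2"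
    using ne by (simp add: grad_def B inner_add_left inner_add_right ii power2_eq_square)
  have tt: "tangent u v \<bullet> tangent u w = v \<bullet> w + dir_deriv v \<gamma> u * dir_deriv w \<gamma> u" for v w
    by (simp add: tangent_def inner_add_left inner_add_right)
  have "(norm (cross3 (tangent u ?a) (tangent u ?b)))\<^sup>2 = 1 + grad u \<bullet> grad u"
    unfolding norm_cross by (simp add: power2_norm_eq_inner tt gg ii) (simp add: algebra_simps power2_eq_square)
  then show ?thesis
    unfolding area_element_eq dir_deriv_chart jac_def by (metis norm_ge_zero real_sqrt_unique)
qed

lemma regular_chart: "regular_parametrization (frontier \<Omega>) dom chart"
  unfolding regular_parametrization_def
proof (intro conjI)
  show "open dom" by (rule open_dom)
  show "smooth_on dom chart" using smooth_chart smooth_on_mono by blast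
  show "\<forall>u\<in>dom. area_element chart u \<noteq> 0" using jac_ge_1 unfolding area_element_chart by (metis not_one_le_zero)
  show "openin (top_of_set (frontier \<Omega>)) (chart ` dom)"
    unfolding chart_dom by (rule openin_open_Int) simp
  show "\<exists>\<psi>. homeomorphism dom (chart ` dom) chart \<psi>"
    by (intro exI[of _ proj]) (auto simp: homeomorphism_def image_image intro: continuous_chart linear_continuous_on bounded_linear_proj)
qed

text \<open>Orthogonality to the lifts of all lines through \<open>u\<close> determines the normal up to sign; pointing upward
  would let the normal ray enter the region above the graph, so it points downward.\<close>

lemma outward_normal_chart:
  assumes u: "u \<in> dom" and \<nu>: "outward_unit_normal \<Omega> (chart u) \<nu>"
  shows "\<nu> = out_normal u"
proof -
  define q s where "q = proj \<nu>" and "s = \<nu> \<bullet> e"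
  have nu: "\<nu> = emb q + s *\<^sub>R e" using decompose[of \<nu>] by (simp add: q_def s_def)
  have norm1: "norm \<nu> = 1" and tang: "\<And>c w. c 0 = chart u \<Longrightarrow> \<forall>\<^sub>F t in nhds (0::real). c t \<in> frontier \<Omega> \<Longrightarrow>
        (c has_vector_derivative w) (at 0) \<Longrightarrow> \<nu> \<bullet> w = 0"
    and outw: "\<forall>\<^sub>F t in at_right (0::real). chart u + t *\<^sub>R \<nu> \<notin> closure \<Omega>"
    using \<nu> unfolding outward_unit_normal_def by blast+
  have qa: "q \<bullet> a = - s * dir_deriv a \<gamma> u" for a
  proof -
    have line: "((\<lambda>t. u + t *\<^sub>R a) has_derivative (\<lambda>t. t *\<^sub>R a)) (at 0)"
      by (auto intro!: derivative_eq_intros)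
    have d: "((\<lambda>t. chart (u + t *\<^sub>R a)) has_vector_derivative tangent u a) (at 0)"
      using has_derivative_compose[OF line, of chart "tangent u"] chart_has_derivative[of u]
        linear_scale[OF has_derivative_linear[OF chart_has_derivative[of u]]]
      by (simp add: has_vector_derivative_def)
    have "((\<lambda>t. u + t *\<^sub>R a) \<longlongrightarrow> u) (nhds 0)"
      by (rule tendsto_eq_intros filterlim_ident refl | simp)+
    from topological_tendstoD[OF this open_dom u]
    have "\<forall>\<^sub>F t in nhds 0. chart (u + t *\<^sub>R a) \<in> frontier \<Omega>"
      by eventually_elim (use chart_dom in blast)
    then have "\<nu> \<bullet> tangent u a = 0"
      by (intro tang[OF _ _ d]) simp_all
    then have "q \<bullet> a + s * dir_deriv a \<gamma> u = 0"
      by (simp add: nu tangent_def inner_add_left inner_add_right mult.commute)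
    then show ?thesis by (simp only: add_eq_0_iff2 mult_minus_left)
  qed
  have q: "q = (- s) *\<^sub>R grad u"
  proof (rule euclidean_eqI)
    fix b :: "real^2" show "q \<bullet> b = (- s) *\<^sub>R grad u \<bullet> b" using qa[of b] by (simp add: grad_inner)
  qed
  have "\<nu> \<bullet> \<nu> = 1" using norm1 by (simp add: norm_eq_1)
  then have "q \<bullet> q + s * s = 1" by (simp add: nu inner_add_left inner_add_right)
  then have "(s * jac u) * (s * jac u) = 1" unfolding q using jac_sq[of u] by (simp add: algebra_simps)
  then have sj: "s * jac u = 1 \<or> s * jac u = -1" by (metis square_eq_1_iff)
  have "\<not> s > 0"
  proof
    assume s: "s > 0"
    let ?h = "\<lambda>t. \<gamma> (u + t *\<^sub>R q) - \<gamma> u - t * s"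
    have line: "((\<lambda>t. u + t *\<^sub>R q) has_derivative (\<lambda>t. t *\<^sub>R q)) (at 0)"
      by (auto intro!: derivative_eq_intros)
    have "(\<gamma> has_derivative (\<lambda>v. dir_deriv v \<gamma> u)) (at (u + 0 *\<^sub>R q))"
      using smooth_on_has_derivative[OF smooth_height, of u] by simp
    from has_derivative_compose[OF line this]
    have "((\<lambda>t. \<gamma> (u + t *\<^sub>R q)) has_real_derivative dir_deriv q \<gamma> u) (at 0)"
      unfolding has_field_derivative_def by (simp add: linear_scale[OF linear_height] mult.commute[of _ "dir_deriv q \<gamma> u"])
    then have "(?h has_real_derivative dir_deriv q \<gamma> u - 0 - s) (at 0)"
      by (auto intro!: derivative_eq_intros)
    moreover have "dir_deriv q \<gamma> u - 0 - s < 0"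
    proof -
      have "dir_deriv q \<gamma> u = - (q \<bullet> q) / s" using qa[of q] s by (simp add: field_simps)
      also have "\<dots> \<le> 0" using s by (simp add: divide_nonpos_pos)
      finally show ?thesis using s by simp
    qed
    ultimately obtain d where d: "d > 0" "\<And>t. t > 0 \<Longrightarrow> t < d \<Longrightarrow> ?h (0 + t) < ?h 0"
      using DERIV_neg_dec_right by blast
    have lim: "((\<lambda>t. chart u + t *\<^sub>R \<nu>) \<longlongrightarrow> chart u) (at_right 0)"
      by (rule tendsto_eq_intros refl | simp)+
    have ev: "\<forall>\<^sub>F t in at_right 0. chart u + t *\<^sub>R \<nu> \<in> ball p r"
      using topological_tendstoD[OF lim open_ball] u by (simp add: dom_def)
    have "\<forall>\<^sub>F t in at_right 0. t \<in> {0<..<d}" using d(1) by (rule eventually_at_right_real)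
    with ev outw have "\<forall>\<^sub>F t in at_right (0::real). False"
    proof eventually_elim
      case (elim t)
      have "?h t < 0" using d(2)[of t] elim by simp
      then have "\<gamma> (proj (chart u + t *\<^sub>R \<nu>)) < (chart u + t *\<^sub>R \<nu>) \<bullet> e"
        by (simp add: linear_add[OF linear_proj] linear_scale[OF linear_proj] q_def[symmetric] s_def[symmetric] inner_add_left)
      then have "chart u + t *\<^sub>R \<nu> \<in> \<Omega>" using elim region_iff by blast
      then show ?case using elim closure_subset by blast
    qed
    then show False by simp
  qed
  then have "s * jac u = -1" using sj jac_ge_1[of u] by (smt (verit) mult_nonneg_nonneg zero_less_mult_pos2)
  then have s: "s = - inverse (jac u)" using jac_ge_1[of u] by (simp add: field_simps)
  show ?thesis
    by (simp add: nu q s out_normal_def linear_scale[OF linear_emb] scaleR_diff_right)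
qed

section \<open>The surface measure in a graph chart\<close>

lemma jac_nonneg: "0 \<le> jac u"
  by (simp add: jac_def)

lemma continuous_jac: "continuous_on A jac"
  using continuous_on_area_element[OF smooth_chart] continuous_on_subset
  unfolding area_element_chart[abs_def] by blast

lemma chart_measurable [measurable]: "chart \<in> borel_measurable borel"
  by (rule borel_measurable_continuous_onI[OF continuous_chart])

lemma jac_measurable [measurable]: "jac \<in> borel_measurable borel"
  by (rule borel_measurable_continuous_onI[OF continuous_jac])

lemma closed_borel_openin:
  assumes "openin (top_of_set S) X" "closed S"
  shows "X \<in> sets borel"
  using assms by (auto simp: openin_open)

lemma jac_bounded:
  obtains C where "C > 0" "\<And>u. u \<in> cball (proj p) r \<Longrightarrow> jac u \<le> C"
proof -
  have "bounded (jac ` cball (proj p) r)"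
    by (intro compact_imp_bounded compact_continuous_image continuous_jac compact_cball)
  then obtain C where C: "C > 0" "\<forall>x\<in>jac ` cball (proj p) r. norm x \<le> C"
    unfolding bounded_pos by blast
  have "jac u \<le> C" if "u \<in> cball (proj p) r" for u
    using C(2)[rule_format, OF imageI[OF that]] by (simp add: abs_le_iff)
  then show thesis using that C(1) by blast
qed

lemma emeasure_chart:
  assumes "A \<in> sets borel"
  shows "emeasure (patch_measure dom chart) A
    = (\<integral>\<^sup>+u. ennreal (jac u) * indicator {u \<in> dom. chart u \<in> A} u \<partial>lborel)"
  using emeasure_patch_measure[OF open_dom smooth_on_mono[OF smooth_chart subset_UNIV] assms]
  by (simp add: area_element_chart)

text \<open>Near the points of \<open>A\<close> the parametrization factors as \<open>\<psi> = chart \<circ> \<tau>\<close> with \<open>\<tau> = proj \<circ> \<psi>\<close>, which is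
  differentiable and injective. The area elements then differ by the Jacobian determinant of \<open>\<tau>\<close>, and \<open>\<tau>\<close>
  maps into the part of the parameter domain that lies over \<open>A\<close>. An inequality suffices, since the chart
  is itself one of the patches.\<close>

lemma patch_measure_le_chart:
  assumes reg: "regular_parametrization (frontier \<Omega>) V \<psi>"
    and A: "A \<in> sets borel" "A \<subseteq> frontier \<Omega> \<inter> ball p r"
  shows "emeasure (patch_measure V \<psi>) A \<le> emeasure (patch_measure dom chart) A"
proof -
  have V: "open V" and sm: "smooth_on V \<psi>" and opn: "openin (top_of_set (frontier \<Omega>)) (\<psi> ` V)"
    and inj\<psi>: "inj_on \<psi> V"
    using reg unfolding regular_parametrization_def homeomorphism_def by (auto intro: inj_on_inverseI)
  have cont: "continuous_on V \<psi>" by (rule smooth_on_imp_continuous_on[OF sm])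
  define W where "W = {v \<in> V. \<psi> v \<in> A}"
  define \<tau> where "\<tau> v = proj (\<psi> v)" for v
  define \<tau>' where "\<tau>' v h = proj (dir_deriv h \<psi> v)" for v h
  have chart_\<tau>: "chart (\<tau> v) = \<psi> v" if "v \<in> V" "\<psi> v \<in> ball p r" for v
  proof -
    have "\<psi> v \<in> frontier \<Omega>" using openin_imp_subset[OF opn] that(1) by blast
    then show ?thesis unfolding \<tau>_def using frontier_iff chart_proj that(2) by blast
  qed
  have WA: "chart (\<tau> v) = \<psi> v" if "v \<in> W" for v
    using chart_\<tau> A(2) that unfolding W_def by blast
  have W_borel: "W \<in> sets borel"
  proof -
    have "\<psi> -` A \<inter> V \<in> sets (restrict_space borel V)"
      using measurable_sets[OF borel_measurable_continuous_on_restrict[OF cont] A(1)]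
      by (simp add: space_restrict_space)
    moreover have "W = \<psi> -` A \<inter> V" by (auto simp: W_def)
    ultimately show ?thesis using V by (simp add: sets_restrict_space_iff)
  qed
  have inj: "inj_on \<tau> W"
  proof (rule inj_onI)
    fix v w assume *: "v \<in> W" "w \<in> W" "\<tau> v = \<tau> w"
    then have "\<psi> v = \<psi> w" using WA by metis
    then show "v = w" using inj\<psi> * unfolding W_def inj_on_def by blast
  qed
  have \<tau>W: "\<tau> ` W = {u \<in> dom. chart u \<in> A \<inter> \<psi> ` V}"
  proof safe
    fix v assume v: "v \<in> W"
    then have *: "v \<in> V" "\<psi> v \<in> A" "\<psi> v \<in> ball p r" using A(2) unfolding W_def by blast+
    then show "\<tau> v \<in> dom" "chart (\<tau> v) \<in> A" "chart (\<tau> v) \<in> \<psi> ` V"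
      unfolding dom_def mem_Collect_eq WA[OF v] by blast+
  next
    fix u v assume *: "u \<in> dom" "chart u \<in> A" "v \<in> V" "chart u = \<psi> v"
    then have "v \<in> W" unfolding W_def by simp
    moreover have "\<tau> v = u" unfolding \<tau>_def *(4)[symmetric] by (rule proj_chart)
    ultimately show "u \<in> \<tau> ` W" by blast
  qed
  have im: "\<tau> ` W \<in> sets borel"
  proof -
    have "A \<inter> \<psi> ` V \<in> sets borel" using closed_borel_openin[OF opn frontier_closed] A(1) by blast
    then have "chart -` (A \<inter> \<psi> ` V) \<inter> space borel \<in> sets borel" by (rule measurable_sets[OF chart_measurable])
    moreover have "\<tau> ` W = dom \<inter> (chart -` (A \<inter> \<psi> ` V) \<inter> space borel)" unfolding \<tau>W by auto
    ultimately show ?thesis using open_dom by auto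
  qed
  have der: "(\<tau> has_derivative \<tau>' v) (at v)" if "v \<in> W" for v
  proof -
    have "(\<psi> has_derivative (\<lambda>h. dir_deriv h \<psi> v)) (at v)"
      using smooth_on_has_derivative[OF sm] that by (auto simp: W_def)
    then show ?thesis
      unfolding \<tau>_def[abs_def] \<tau>'_def[abs_def]
      by (rule bounded_linear.has_derivative[OF bounded_linear_proj])
  qed
  have area: "area_element \<psi> v = \<bar>det (matrix (\<tau>' v))\<bar> * jac (\<tau> v)" if v: "v \<in> W" for v
  proof -
    have "{v \<in> V. \<psi> v \<in> ball p r} = V \<inter> \<psi> -` ball p r" by blast
    then have near: "open {v \<in> V. \<psi> v \<in> ball p r}"
      using continuous_open_preimage[OF cont V open_ball] by (simp only:)
    have v_near: "v \<in> {v \<in> V. \<psi> v \<in> ball p r}" using v A(2) unfolding W_def by blast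
    have "((\<lambda>v. chart (\<tau> v)) has_derivative (\<lambda>h. tangent (\<tau> v) (\<tau>' v h))) (at v)"
      by (rule has_derivative_compose[OF der[OF v] chart_has_derivative])
    then have "(\<psi> has_derivative (\<lambda>h. tangent (\<tau> v) (\<tau>' v h))) (at v)"
      by (rule has_derivative_transform_within_open[OF _ near v_near]) (auto simp only: mem_Collect_eq chart_\<tau>)
    then have d: "dir_deriv h \<psi> v = tangent (\<tau> v) (\<tau>' v h)" for h
      by (rule dir_deriv_eqI)
    let ?m = "matrix (\<tau>' v)"
    let ?t = "tangent (\<tau> v)"
    have lt: "linear ?t" using chart_has_derivative has_derivative_linear by blast
    have cols: "\<tau>' v (axis j 1) = ?m $ 1 $ j *\<^sub>R axis 1 1 + ?m $ 2 $ j *\<^sub>R axis 2 1" for j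
      by (simp add: matrix_def vec_eq_iff forall_2 axis_def)
    have "cross3 (?t (\<tau>' v (axis 1 1))) (?t (\<tau>' v (axis 2 1))) = det ?m *\<^sub>R cross3 (?t (axis 1 1)) (?t (axis 2 1))"
      unfolding cols linear_add[OF lt] linear_scale[OF lt] det_2
      by (simp add: cross_add_left cross_add_right cross_mult_left cross_mult_right
          cross_skew[of "?t (axis 2 1)" "?t (axis 1 1)"] algebra_simps)
    then show ?thesis
      unfolding area_element_eq[of \<psi>] d area_element_chart[symmetric] area_element_eq[of chart] dir_deriv_chart
      by simp
  qed
  obtain a where a: "\<tau> ` W \<subseteq> cbox (- a) a"
  proof -
    have "bounded (\<tau> ` W)" by (rule bounded_subset[OF bounded_cball[of "proj p" r]]) (use dom_bounded in \<open>auto simp: \<tau>W\<close>)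
    then show thesis using that bounded_subset_cbox_symmetric by blast
  qed
  have "emeasure (patch_measure V \<psi>) A = (\<integral>\<^sup>+v. ennreal (area_element \<psi> v) * indicator W v \<partial>lborel)"
    unfolding W_def by (rule emeasure_patch_measure[OF V sm A(1)])
  also have "\<dots> = (\<integral>\<^sup>+v. ennreal (\<bar>det (matrix (\<tau>' v))\<bar> * jac (\<tau> v)) * indicator W v \<partial>lborel)"
    by (intro nn_integral_cong) (simp add: area indicator_def)
  also have "\<dots> = (\<integral>\<^sup>+u. ennreal (jac u) * indicator (\<tau> ` W) u \<partial>lborel)"
    by (rule nn_integral_change_of_variables[OF _ der inj _ a continuous_jac])
       (use W_borel im in \<open>simp_all add: jac_nonneg\<close>)
  also have "\<dots> \<le> (\<integral>\<^sup>+u. ennreal (jac u) * indicator {u \<in> dom. chart u \<in> A} u \<partial>lborel)"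
    by (intro nn_integral_mono) (auto simp: \<tau>W indicator_def)
  also have "\<dots> = emeasure (patch_measure dom chart) A" by (rule emeasure_chart[OF A(1), symmetric])
  finally show ?thesis .
qed

lemma sets_surface_measure: "sets (surface_measure (frontier \<Omega>)) = sets borel"
  unfolding surface_measure_def by (rule sets_Sup_borel) (use regular_chart in auto)

lemma emeasure_surface_measure:
  assumes "A \<in> sets borel" "A \<subseteq> frontier \<Omega> \<inter> ball p r"
  shows "emeasure (surface_measure (frontier \<Omega>)) A = emeasure (patch_measure dom chart) A"
  unfolding surface_measure_def
proof (rule emeasure_Sup_dominated[where Q = "frontier \<Omega> \<inter> ball p r"])
  show "patch_measure dom chart \<in> {patch_measure U \<phi> |U \<phi>. regular_parametrization (frontier \<Omega>) U \<phi>}"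
    using regular_chart by blast
  show "frontier \<Omega> \<inter> ball p r \<in> sets borel" by (intro sets.Int) (auto simp: frontier_closed)
qed (use patch_measure_le_chart assms in auto)

lemma emeasure_surface_measure_finite:
  "emeasure (surface_measure (frontier \<Omega>)) (frontier \<Omega> \<inter> ball p r) < \<infinity>"
proof -
  obtain C where C: "C > 0" "\<And>u. u \<in> cball (proj p) r \<Longrightarrow> jac u \<le> C" using jac_bounded by blast
  have "frontier \<Omega> \<inter> ball p r \<in> sets borel" by (intro sets.Int) (auto simp: frontier_closed)
  then have "emeasure (surface_measure (frontier \<Omega>)) (frontier \<Omega> \<inter> ball p r)
      = (\<integral>\<^sup>+u. ennreal (jac u) * indicator {u \<in> dom. chart u \<in> frontier \<Omega> \<inter> ball p r} u \<partial>lborel)"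
    by (subst emeasure_surface_measure) (auto simp: emeasure_chart)
  also have "\<dots> \<le> (\<integral>\<^sup>+u. ennreal C * indicator (cball (proj p) r) u \<partial>lborel)"
    using C dom_bounded by (intro nn_integral_mono) (auto simp: indicator_def intro!: ennreal_leI)
  also have "\<dots> = ennreal C * emeasure lborel (cball (proj p) r)"
    by (rule nn_integral_cmult_indicator) simp
  also have "\<dots> < \<infinity>"
    using emeasure_bounded_finite[OF bounded_cball, of "proj p" r] by (simp add: ennreal_mult_less_top)
  finally show ?thesis .
qed

lemma chart_image_borel:
  assumes "open B" "B \<subseteq> dom"
  shows "chart ` B \<in> sets borel"
proof -
  have "chart ` B = frontier \<Omega> \<inter> (ball p r \<inter> proj -` B)"
  proof (intro equalityI subsetI)
    fix x assume "x \<in> chart ` B"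
    then obtain u where u: "u \<in> B" "x = chart u" by blast
    then have "x \<in> frontier \<Omega> \<inter> ball p r" using assms(2) chart_dom by blast
    with u show "x \<in> frontier \<Omega> \<inter> (ball p r \<inter> proj -` B)" by simp
  next
    fix x assume x: "x \<in> frontier \<Omega> \<inter> (ball p r \<inter> proj -` B)"
    then have "chart (proj x) = x" using frontier_iff chart_proj by blast
    with x show "x \<in> chart ` B" by (metis IntD2 imageI vimage_eq)
  qed
  moreover have "open (proj -` B)"
    by (rule open_vimage[OF assms(1)]) (rule linear_continuous_on[OF bounded_linear_proj])
  ultimately show ?thesis by (auto simp: frontier_closed)
qed

lemma surface_integral_chart:
  fixes h :: "real^3 \<Rightarrow> real"
  assumes B: "open B" "B \<subseteq> dom" and h [measurable]: "h \<in> borel_measurable borel"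
  shows "(LINT x:chart ` B|surface_measure (frontier \<Omega>). h x) = (LINT u:B|lborel. jac u * h (chart u))"
proof -
  let ?\<mu> = "surface_measure (frontier \<Omega>)" and ?P = "patch_measure dom chart" and ?Q = "chart ` B"
  let ?R = "restrict_space lborel dom"
  have Q [measurable]: "?Q \<in> sets borel" by (rule chart_image_borel[OF B])
  have hm [measurable]: "h \<in> borel_measurable ?\<mu>" "h \<in> borel_measurable ?P"
    by (simp_all add: measurable_cong_sets[OF sets_surface_measure refl] measurable_cong_sets[OF sets_patch_measure refl])
  have Qm [measurable]: "?Q \<in> sets ?\<mu>" "?Q \<in> sets ?P" by (simp_all add: sets_surface_measure Q)
  have Qs: "?Q \<subseteq> frontier \<Omega> \<inter> ball p r" using B(2) chart_dom by blast
  have eq: "density ?\<mu> (indicator ?Q) = density ?P (indicator ?Q)"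
  proof (rule measure_eqI)
    fix A assume "A \<in> sets (density ?\<mu> (indicator ?Q))"
    then have A: "A \<in> sets borel" by (simp add: sets_surface_measure)
    then have "emeasure ?\<mu> (?Q \<inter> A) = emeasure ?P (?Q \<inter> A)"
      by (intro emeasure_surface_measure) (use Qs Q in auto)
    then show "emeasure (density ?\<mu> (indicator ?Q)) A = emeasure (density ?P (indicator ?Q)) A"
      using A Q by (simp add: emeasure_density sets_surface_measure nn_integral_indicator flip: indicator_inter_arith)
  qed (simp add: sets_surface_measure)
  have ind: "(indicator ?Q :: _ \<Rightarrow> ennreal) = (\<lambda>x. ennreal (indicator ?Q x))"
    by (auto simp: indicator_def)
  have "(LINT x:?Q|?\<mu>. h x) = (LINT x|density ?\<mu> (indicator ?Q). h x)"
    unfolding ind set_lebesgue_integral_def by (subst integral_density) auto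
  also have "\<dots> = (LINT x|?P. indicator ?Q x *\<^sub>R h x)"
    unfolding eq unfolding ind by (subst integral_density) auto
  also have "\<dots> = (LINT u|density ?R (\<lambda>u. ennreal (area_element chart u)). indicator ?Q (chart u) *\<^sub>R h (chart u))"
    unfolding patch_measure_def
    by (subst integral_distr) (use measurable_patch[OF open_dom smooth_on_mono[OF smooth_chart]] in auto)
  also have "\<dots> = (LINT u|?R. jac u *\<^sub>R (indicator ?Q (chart u) *\<^sub>R h (chart u)))"
    unfolding area_element_chart
  proof (rule integral_density)
    have [measurable]: "chart \<in> ?R \<rightarrow>\<^sub>M borel" "jac \<in> ?R \<rightarrow>\<^sub>M borel" by (simp_all add: measurable_restrict_space1)
    show "(\<lambda>u. indicator ?Q (chart u) *\<^sub>R h (chart u)) \<in> borel_measurable ?R" "jac \<in> borel_measurable ?R" by measurable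
    show "AE u in ?R. 0 \<le> jac u" by (simp add: jac_nonneg)
  qed
  also have "\<dots> = (LINT u:dom|lborel. jac u *\<^sub>R (indicator ?Q (chart u) *\<^sub>R h (chart u)))"
    unfolding set_lebesgue_integral_def by (rule integral_restrict_space) (use open_dom in auto)
  also have "\<dots> = (LINT u:B|lborel. jac u * h (chart u))"
  proof -
    have "chart u \<in> ?Q \<longleftrightarrow> u \<in> B" for u using inj_image_mem_iff[OF inj_chart] .
    then show ?thesis unfolding set_lebesgue_integral_def
      using B(2) by (intro Bochner_Integration.integral_cong) (auto simp: indicator_def)
  qed
  finally show ?thesis .
qed

end

section \<open>Symmetrized integrals over the parameter plane\<close>

lemma nn_integral_inverse_1_plus_square_finite:
  "(\<integral>\<^sup>+x. ennreal (1 / (1 + x\<^sup>2)) \<partial>lborel) < \<infinity>"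
proof -
  have "integrable lborel (\<lambda>x::real. 1 / (1 + x\<^sup>2))"
    using integrable_inverse_1_plus_square by (simp add: set_integrable_def inverse_eq_divide)
  then show ?thesis
    by (subst nn_integral_eq_integral) auto
qed

text \<open>The integrand is dominated by \<open>\<delta>\<close> times a product of one-dimensional functions \<open>1/(1+(x/\<delta>)\<^sup>2)\<close>, each
  with integral proportional to \<open>\<delta>\<close>; two coordinates and the prefactor give \<open>\<delta>^3\<close>.\<close>

lemma decay_integral_bound:
  obtains C where "C > 0" "\<And>\<delta>. \<delta> > 0 \<Longrightarrow>
    (\<integral>\<^sup>+w. ennreal (norm (w :: real^2) / (1 + (norm w / \<delta>)\<^sup>2) ^ 3) \<partial>lborel) \<le> ennreal (C * \<delta> ^ 3)"
proof -
  define I where "I = enn2real (\<integral>\<^sup>+x. ennreal (1 / (1 + x\<^sup>2)) \<partial>lborel)"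
  have I: "(\<integral>\<^sup>+x. ennreal (1 / (1 + x\<^sup>2)) \<partial>lborel) = ennreal I"
    unfolding I_def using nn_integral_inverse_1_plus_square_finite by simp
  have I0: "I \<ge> 0" by (simp add: I_def)
  have "(\<integral>\<^sup>+w. ennreal (norm (w :: real^2) / (1 + (norm w / \<delta>)\<^sup>2) ^ 3) \<partial>lborel) \<le> ennreal ((I\<^sup>2 + 1) * \<delta> ^ 3)"
    if \<delta>: "\<delta> > 0" for \<delta>
  proof -
    let ?f = "\<lambda>x. ennreal (1 / (1 + (x / \<delta>)\<^sup>2))"
    have card: "card (Basis :: (real^2) set) = 2" by simp
    have pt: "ennreal (norm w / (1 + (norm w / \<delta>)\<^sup>2) ^ 3) \<le> ennreal \<delta> * (\<Prod>b\<in>Basis. ?f (w \<bullet> b))" for w :: "real^2"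
    proof -
      let ?q = "1 + (norm w / \<delta>)\<^sup>2"
      have q: "?q > 0" by (simp add: add_pos_nonneg)
      have "(\<Prod>b\<in>(Basis :: (real^2) set). 1 / ?q) \<le> (\<Prod>b\<in>Basis. 1 / (1 + (w \<bullet> b / \<delta>)\<^sup>2))"
      proof (rule prod_mono)
        fix b :: "real^2" assume "b \<in> Basis"
        then have "\<bar>w \<bullet> b\<bar> \<le> norm w" by (rule Basis_le_norm)
        then have "(w \<bullet> b)\<^sup>2 \<le> (norm w)\<^sup>2" by (simp add: abs_le_square_iff[symmetric])
        then have "(w \<bullet> b / \<delta>)\<^sup>2 \<le> (norm w / \<delta>)\<^sup>2"
          by (simp add: power_divide divide_right_mono)
        then show "0 \<le> 1 / ?q \<and> 1 / ?q \<le> 1 / (1 + (w \<bullet> b / \<delta>)\<^sup>2)"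
          using q by (auto intro!: frac_le add_pos_nonneg)
      qed
      then have 1: "1 / ?q ^ 2 \<le> (\<Prod>b\<in>Basis. 1 / (1 + (w \<bullet> b / \<delta>)\<^sup>2))"
        by (simp only: prod_constant card power_one_over)
      have "norm w / \<delta> \<le> ?q" by (rule le_one_plus_square)
      then have "norm w \<le> \<delta> * ?q" using \<delta> by (simp add: pos_divide_le_eq mult.commute)
      then have "norm w / ?q ^ 3 \<le> \<delta> * ?q / ?q ^ 3" using q by (intro divide_right_mono) auto
      also have "\<dots> = \<delta> * (1 / ?q ^ 2)" using q by (simp add: power3_eq_cube power2_eq_square)
      also have "\<dots> \<le> \<delta> * (\<Prod>b\<in>Basis. 1 / (1 + (w \<bullet> b / \<delta>)\<^sup>2))"
        using 1 \<delta> by (intro mult_left_mono) auto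
      finally have "ennreal (norm w / ?q ^ 3) \<le> ennreal (\<delta> * (\<Prod>b\<in>Basis. 1 / (1 + (w \<bullet> b / \<delta>)\<^sup>2)))"
        by (rule ennreal_leI)
      also have "\<dots> = ennreal \<delta> * (\<Prod>b\<in>Basis. ?f (w \<bullet> b))"
        using \<delta> by (simp add: ennreal_mult'' prod_ennreal prod_nonneg)
      finally show ?thesis .
    qed
    have one_dim: "(\<integral>\<^sup>+x. ?f x \<partial>lborel) = ennreal (\<delta> * I)"
    proof -
      have "(\<integral>\<^sup>+x. ?f x \<partial>lborel) = ennreal \<bar>\<delta>\<bar> * (\<integral>\<^sup>+x. ?f (0 + \<delta> * x) \<partial>lborel)"
        by (rule nn_integral_real_affine) (use \<delta> in auto)
      then show ?thesis using \<delta> I0 I by (simp add: ennreal_mult)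
    qed
    have "(\<integral>\<^sup>+w. ennreal (norm (w :: real^2) / (1 + (norm w / \<delta>)\<^sup>2) ^ 3) \<partial>lborel)
        \<le> (\<integral>\<^sup>+w. ennreal \<delta> * (\<Prod>b\<in>Basis. ?f ((w :: real^2) \<bullet> b)) \<partial>lborel)"
      by (intro nn_integral_mono pt)
    also have "\<dots> = ennreal \<delta> * (\<integral>\<^sup>+w. (\<Prod>b\<in>Basis. ?f ((w :: real^2) \<bullet> b)) \<partial>lborel)"
      by (rule nn_integral_cmult) measurable
    also have "(\<integral>\<^sup>+w. (\<Prod>b\<in>Basis. ?f ((w :: real^2) \<bullet> b)) \<partial>lborel) = (\<Prod>b\<in>(Basis :: (real^2) set). (\<integral>\<^sup>+x. ?f x \<partial>lborel))"
      by (rule nn_integral_lborel_prod) auto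
    also have "\<dots> = ennreal (\<delta> * I) ^ 2" by (simp add: one_dim card)
    also have "ennreal \<delta> * ennreal (\<delta> * I) ^ 2 = ennreal (I\<^sup>2 * \<delta> ^ 3)"
      using \<delta> I0 by (simp add: ennreal_power flip: ennreal_mult) (simp add: power_mult_distrib power2_eq_square power3_eq_cube mult_ac)
    also have "\<dots> \<le> ennreal ((I\<^sup>2 + 1) * \<delta> ^ 3)"
      using \<delta> by (intro ennreal_leI mult_right_mono) auto
    finally show ?thesis .
  qed
  moreover have "I\<^sup>2 + 1 > 0" by (simp add: add_nonneg_pos)
  ultimately show thesis using that by blast
qed

lemma abs_symmetrized_product_le:
  fixes m m' g g' :: real
  assumes "\<bar>m + m'\<bar> \<le> a" "\<bar>m'\<bar> \<le> b" "\<bar>g\<bar> \<le> c" "\<bar>g' - g\<bar> \<le> d"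
  shows "\<bar>m * g + m' * g'\<bar> \<le> a * c + b * d"
proof -
  have "m * g + m' * g' = (m + m') * g + m' * (g' - g)" by (simp add: algebra_simps)
  also have "\<bar>\<dots>\<bar> \<le> \<bar>m + m'\<bar> * \<bar>g\<bar> + \<bar>m'\<bar> * \<bar>g' - g\<bar>"
    using abs_triangle_ineq[of "(m + m') * g" "m' * (g' - g)"] by (simp only: abs_mult)
  also have "\<dots> \<le> a * c + b * d"
    by (rule add_mono; rule mult_mono[OF assms(1,3)] mult_mono[OF assms(2,4)]; use assms in linarith)
  finally show ?thesis .
qed

lemma lborel_distr_uminus_euclidean:
  "distr lborel borel uminus = (lborel :: 'a::euclidean_space measure)"
proof -
  have "(lborel :: 'a measure)
      = density (distr lborel borel (\<lambda>x. 0 + (-1) *\<^sub>R x)) (\<lambda>_. ennreal (\<bar>-1 :: real\<bar> ^ DIM('a)))"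
    using lborel_affine[of "-1" "0 :: 'a"] by simp
  also have "\<dots> = distr lborel borel uminus"
    by (simp add: density_1)
  finally show ?thesis by simp
qed

text \<open>Only the even part of the integrand contributes over a ball centred at the origin. A
  non-integrable \<open>h\<close> has integral \<open>0\<close> by convention.\<close>

lemma symmetrized_integral_bound:
  fixes h D :: "'a::euclidean_space \<Rightarrow> real"
  assumes bound: "\<And>w. w \<in> ball 0 \<epsilon> \<Longrightarrow> \<bar>h w + h (- w)\<bar> \<le> D w"
    and D: "\<And>w. 0 \<le> D w" "(\<integral>\<^sup>+w. ennreal (D w) \<partial>lborel) \<le> ennreal c" "D \<in> borel_measurable borel" and c: "0 \<le> c"
  shows "\<bar>LINT w:ball 0 \<epsilon>|lborel. h w\<bar> \<le> c"
proof (cases "set_integrable lborel (ball 0 \<epsilon>) h")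
  case False
  then show ?thesis
    using c by (simp add: set_lebesgue_integral_def set_integrable_def not_integrable_integral_eq)
next
  case True
  define g where "g w = indicator (ball 0 \<epsilon>) w *\<^sub>R h w" for w
  have int: "integrable lborel g" using True by (simp add: set_integrable_def g_def[abs_def])
  then have meas: "g \<in> borel_measurable borel" by (simp add: borel_measurable_integrable)
  have refl_int: "integrable lborel (\<lambda>w. g (- w))" and refl_eq: "(LINT w|lborel. g (- w)) = (LINT w|lborel. g w)"
    using integrable_distr[of uminus lborel borel g] integral_distr[of uminus lborel borel g] int meas
    by (simp_all add: lborel_distr_uminus_euclidean)
  have "2 * (LINT w|lborel. g w) = (LINT w|lborel. g w + g (- w))"
    by (subst Bochner_Integration.integral_add[OF int refl_int]) (simp add: refl_eq)
  then have "2 * \<bar>LINT w|lborel. g w\<bar> = \<bar>LINT w|lborel. g w + g (- w)\<bar>" by simp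
  also have "\<dots> \<le> (LINT w|lborel. D w)"
  proof (rule integral_abs_bound_integral)
    show "integrable lborel (\<lambda>w. g w + g (- w))" by (intro Bochner_Integration.integrable_add int refl_int)
    show "integrable lborel D"
      using D by (intro integrableI_bounded) (auto simp: order.strict_trans1[OF _ ennreal_less_top])
    show "\<bar>g w + g (- w)\<bar> \<le> D w" for w
      using bound[of w] D(1)[of w] by (auto simp: indicator_def g_def)
  qed
  also have "\<dots> \<le> c"
    using D c by (subst integral_eq_nn_integral) (auto intro!: enn2real_leI)
  finally show ?thesis by (simp add: set_lebesgue_integral_def g_def c)
qed

lemma set_integral_translate:
  fixes h :: "'a::euclidean_space \<Rightarrow> real"
  assumes "h \<in> borel_measurable borel"
  shows "(LINT u:ball a \<epsilon>|lborel. h u) = (LINT w:ball 0 \<epsilon>|lborel. h (a + w))"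
proof -
  have "(LINT u:ball a \<epsilon>|lborel. h u) = (LINT u|distr lborel borel ((+) a). indicator (ball a \<epsilon>) u *\<^sub>R h u)"
    by (simp add: lborel_distr_plus set_lebesgue_integral_def)
  also have "\<dots> = (LINT w|lborel. indicator (ball a \<epsilon>) (a + w) *\<^sub>R h (a + w))"
  proof (rule integral_distr)
    have [measurable]: "h \<in> borel_measurable borel" "ball a \<epsilon> \<in> sets borel" using assms by simp_all
    show "(\<lambda>u. indicator (ball a \<epsilon>) u *\<^sub>R h u) \<in> borel_measurable borel" by measurable
  qed simp
  also have "\<dots> = (LINT w:ball 0 \<epsilon>|lborel. h (a + w))"
    unfolding set_lebesgue_integral_def
    by (intro Bochner_Integration.integral_cong) (auto simp: indicator_def dist_norm)
  finally show ?thesis .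
qed

section \<open>Local expansion of the kernel\<close>

definition numerator :: "(real^3 \<Rightarrow> real^3) \<Rightarrow> (real^3 \<Rightarrow> real) \<Rightarrow> real^3 \<Rightarrow> real^3 \<Rightarrow> real" where
  "numerator n f y x = (f x *\<^sub>R n y + f y *\<^sub>R n x) \<bullet> (y - x)"

context graph_chart
begin

text \<open>The area element cancels the normalization of the normal at \<open>chart (u + w)\<close>, while the normal at
  \<open>chart u\<close> contributes the constant \<open>1 / jac u\<close>. The scalar products are \<open>quad_rem\<close> and minus
  \<open>quad_rem + double_layer_defect\<close>, respectively.\<close>

lemma numerator_chart:
  assumes "n (chart u) = out_normal u" "n (chart (u + w)) = out_normal (u + w)"
  shows "jac (u + w) * numerator n f (chart u) (chart (u + w))
    = (f (chart (u + w)) * jac (u + w) / jac u - f (chart u)) * quad_rem \<gamma> u w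
      - f (chart u) * double_layer_defect \<gamma> u w"
proof -
  have j: "jac u \<noteq> 0" "jac (u + w) \<noteq> 0" using jac_ge_1 by (metis not_one_le_zero)+
  have diff: "chart u - chart (u + w) = - emb w - (\<gamma> (u + w) - \<gamma> u) *\<^sub>R e"
    by (simp add: chart_def linear_add[OF linear_emb] scaleR_diff_left)
  have scaled: "jac v * (out_normal v \<bullet> x) = (emb (grad v) - e) \<bullet> x" for v x
    using jac_ge_1[of v] by (simp add: out_normal_def)
  have ny: "jac u * (out_normal u \<bullet> (chart u - chart (u + w))) = quad_rem \<gamma> u w"
    unfolding scaled diff
    by (simp add: quad_rem_def inner_diff_left inner_diff_right grad_inner)
  have nx: "jac (u + w) * (out_normal (u + w) \<bullet> (chart u - chart (u + w)))
      = - quad_rem \<gamma> u w - double_layer_defect \<gamma> u w"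
    unfolding scaled diff
    by (simp add: quad_rem_def double_layer_defect_def inner_diff_left inner_diff_right grad_inner)
  have ny': "out_normal u \<bullet> (chart u - chart (u + w)) = quad_rem \<gamma> u w / jac u"
    using ny j by (simp add: field_simps)
  have "jac (u + w) * numerator n f (chart u) (chart (u + w))
      = f (chart (u + w)) * jac (u + w) * (quad_rem \<gamma> u w / jac u)
        + f (chart u) * (jac (u + w) * (out_normal (u + w) \<bullet> (chart u - chart (u + w))))"
    unfolding numerator_def assms inner_add_left inner_scaleR_left ny' by (simp add: algebra_simps)
  then show ?thesis unfolding nx by (simp add: algebra_simps)
qed

lemma chart_diff: "chart (u + w) - chart u = tangent u w + quad_rem \<gamma> u w *\<^sub>R e"
  by (simp add: chart_def tangent_def quad_rem_def linear_add[OF linear_emb] algebra_simps)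

lemma norm_chart_diff_sq:
  "(norm (chart (u + w) - chart u))\<^sup>2 = (norm w)\<^sup>2 + (dir_deriv w \<gamma> u + quad_rem \<gamma> u w)\<^sup>2"
  unfolding chart_diff tangent_def power2_norm_eq_inner
  by (simp add: inner_add_left inner_add_right power2_eq_square algebra_simps)

lemma norm_le_chart_diff: "norm w \<le> norm (chart (u + w) - chart u)"
  by (rule power2_le_imp_le) (simp_all add: norm_chart_diff_sq)

lemma affine_jac: "affine_at_0 (\<lambda>w. jac (u + w))"
proof -
  have sum: "affine_at_0 (\<lambda>w. \<Sum>b\<in>B. dir_deriv b \<gamma> (u + w) * dir_deriv b \<gamma> (u + w))" if "finite B" for B
    using that
  proof (induction B rule: finite_induct)
    case (insert b B)
    have "affine_at_0 (\<lambda>w. dir_deriv b \<gamma> (u + w))"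
      by (rule affine_at_0_smooth[OF smooth_on_dir_deriv[OF smooth_height]])
    then show ?case
      using insert by (simp add: affine_at_0_add affine_at_0_mult)
  qed (simp add: affine_at_0_const)
  have "grad u \<bullet> grad u = (\<Sum>b\<in>Basis. dir_deriv b \<gamma> u * dir_deriv b \<gamma> u)" for u
    by (subst euclidean_inner) (simp add: grad_inner)
  then show ?thesis
    unfolding jac_def using sum[OF finite_Basis]
    by (intro affine_at_0_sqrt affine_at_0_add affine_at_0_const) (simp_all add: sum_nonneg)
qed

text \<open>The squared distance is \<open>|w|\<^sup>2 + (D\<gamma>(u) w + quad_rem)\<^sup>2\<close>. Its odd part is the product of the even part
  of the height increment, of order two, and its odd part, of order one.\<close>

lemma distance_expansion:
  "bigo_norm (\<lambda>w. norm (chart (u + w) - chart u)) 1"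
  "bigo_norm (\<lambda>w. (norm (chart (u + w) - chart u))\<^sup>2 - (norm (chart (u + - w) - chart u))\<^sup>2) 3"
proof -
  let ?K = "quad_rem \<gamma> u" and ?D = "\<lambda>w. dir_deriv w \<gamma> u"
  note K = quad_rem_expansion[OF smooth_height, of u]
  have D: "bigo_norm ?D 1"
    using iter_dir_deriv_bigo[OF open_UNIV smooth_height, where j = 1 and u = u] by simp
  have DK: "bigo_norm (\<lambda>w. ?D w + ?K w) 1"
    by (rule sum_in_bigo(1)[OF D bigo_norm_weaken[OF K(1)]]) simp
  have id: "bigo_norm (\<lambda>w :: real^2. norm w) 1" by simp
  have "norm (chart (u + w) - chart u) \<le> norm w + \<bar>?D w + ?K w\<bar>" for w
    by (rule power2_le_imp_le) (simp_all add: norm_chart_diff_sq power2_sum)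
  moreover have "bigo_norm (\<lambda>w. norm w + \<bar>?D w + ?K w\<bar>) 1"
    by (rule sum_in_bigo(1)[OF id]) (simp only: landau_o.big.abs_in_iff DK)
  ultimately show "bigo_norm (\<lambda>w. norm (chart (u + w) - chart u)) 1"
    by - (rule landau_o.big_trans[OF bigoI[of _ 1]], auto)
  have odd: "?D (- w) = - ?D w" for w using linear_neg[OF linear_height] .
  have "bigo_norm (\<lambda>w. (?K w + ?K (- w)) * (?D w + ?K w + - (?D (- w) + ?K (- w)))) 3"
    by (rule bigo_norm_mult[OF sum_in_bigo(1)[OF K(1) bigo_norm_reflect[OF K(1)]]
          sum_in_bigo(2)[OF DK bigo_norm_reflect[OF DK], unfolded diff_conv_add_uminus]]) simp
  moreover have "(norm (chart (u + w) - chart u))\<^sup>2 - (norm (chart (u + - w) - chart u))\<^sup>2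
      = (?K w + ?K (- w)) * (?D w + ?K w + - (?D (- w) + ?K (- w)))" for w
    unfolding norm_chart_diff_sq odd norm_minus_cancel by (simp add: power2_eq_square algebra_simps)
  ultimately show "bigo_norm (\<lambda>w. (norm (chart (u + w) - chart u))\<^sup>2 - (norm (chart (u + - w) - chart u))\<^sup>2) 3"
    by (simp only:)
qed

text \<open>All the pointwise information on the kernel that enters the error estimate, on one common ball.\<close>

lemma local_expansion:
  assumes u: "u \<in> dom" and f: "smooth_on_subset (frontier \<Omega>) f"
    and n: "\<And>v. v \<in> dom \<Longrightarrow> n (chart v) = out_normal v"
  obtains \<epsilon> C where "\<epsilon> > 0" "C > 0" "ball u \<epsilon> \<subseteq> dom"
    "\<And>w. w \<in> ball 0 \<epsilon> \<Longrightarrow> \<bar>jac (u + w) * numerator n f (chart u) (chart (u + w))\<bar> \<le> C * norm w ^ 3"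
    "\<And>w. w \<in> ball 0 \<epsilon> \<Longrightarrow> \<bar>jac (u + w) * numerator n f (chart u) (chart (u + w))
        + jac (u + - w) * numerator n f (chart u) (chart (u + - w))\<bar> \<le> C * norm w ^ 4"
    "\<And>w. w \<in> ball 0 \<epsilon> \<Longrightarrow> \<bar>norm (chart (u + w) - chart u) - norm (chart (u + - w) - chart u)\<bar> \<le> C * norm w ^ 2"
proof -
  have "chart u \<in> frontier \<Omega>" using u chart_dom by blast
  then obtain U F where U: "open U" "chart u \<in> U" "smooth_on U F"
    and fF: "\<And>x. x \<in> frontier \<Omega> \<Longrightarrow> x \<in> U \<Longrightarrow> f x = F x"
    using f unfolding smooth_on_subset_def by (metis IntI)
  let ?K = "quad_rem \<gamma> u" and ?E = "double_layer_defect \<gamma> u"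
  define z where "z w = chart (u + w) - chart u" for w
  \<comment> \<open>formed with the extension \<open>F\<close>; it agrees with the expression in \<open>f\<close> as long as the chart stays in \<open>U\<close>\<close>
  define H where "H w = F (chart (u + w)) * jac (u + w) / jac u" for w
  define N where "N w = (H w - H 0) * ?K w - H 0 * ?E w" for w
  define M where "M w = jac (u + w) * numerator n f (chart u) (chart (u + w))" for w
  note K = quad_rem_expansion[OF smooth_height, of u] and E = double_layer_defect_expansion[OF smooth_height, of u]
  note dist = distance_expansion[of u, folded z_def]
  have lt: "linear (tangent u)" using chart_has_derivative has_derivative_linear by blast
  have "z w + z (- w) = (?K w + ?K (- w)) *\<^sub>R e" for w
    unfolding z_def chart_diff linear_neg[OF lt] by (simp add: scaleR_add_left)
  then have "norm (z w + z (- w)) = \<bar>?K w + ?K (- w)\<bar>" for w by (simp add: norm_eq_sqrt_inner)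
  then have z2: "bigo_norm (\<lambda>w. norm (z w + z (- w))) 2"
    using sum_in_bigo(1)[OF K(1) bigo_norm_reflect[OF K(1)]] by simp
  have "affine_at_0 (\<lambda>w. F (chart (u + w)))"
    by (rule affine_at_0_compose[OF U dist(1) z2]) (simp_all add: z_def)
  then have H: "affine_at_0 H"
    unfolding H_def[abs_def] divide_inverse
    by (intro affine_at_0_mult affine_jac affine_at_0_const)
  have N: "bigo_norm N 3" "bigo_norm (\<lambda>w. N w + N (- w)) 4"
    by (rule numerator_cancellation[OF H K E]; simp add: N_def)+
  obtain C1 where C1: "C1 > 0" "\<forall>\<^sub>F w in nhds 0. \<bar>N w\<bar> \<le> C1 * norm w ^ 3" using bigo_normE[OF N(1)] .
  obtain C2 where C2: "C2 > 0" "\<forall>\<^sub>F w in nhds 0. \<bar>N w + N (- w)\<bar> \<le> C2 * norm w ^ 4" using bigo_normE[OF N(2)] .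
  obtain C3 where C3: "C3 > 0" "\<forall>\<^sub>F w in nhds 0. \<bar>(norm (z w))\<^sup>2 - (norm (z (- w)))\<^sup>2\<bar> \<le> C3 * norm w ^ 3"
    using bigo_normE[OF dist(2)] .
  have "((\<lambda>w. u + w) \<longlongrightarrow> u) (nhds 0)"
    by (rule tendsto_eq_intros filterlim_ident refl | simp)+
  moreover have "open (dom \<inter> chart -` U)" "u \<in> dom \<inter> chart -` U"
    using open_vimage[OF U(1) continuous_chart] open_dom u U(2) by auto
  ultimately have ev: "\<forall>\<^sub>F w in nhds 0. u + w \<in> dom \<inter> chart -` U"
    using topological_tendstoD by blast
  obtain \<epsilon> where \<epsilon>: "\<epsilon> > 0" and near: "\<And>w. dist w 0 < \<epsilon> \<Longrightarrow> \<bar>N w\<bar> \<le> C1 * norm w ^ 3 \<and> \<bar>N w + N (- w)\<bar> \<le> C2 * norm w ^ 4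
      \<and> \<bar>(norm (z w))\<^sup>2 - (norm (z (- w)))\<^sup>2\<bar> \<le> C3 * norm w ^ 3 \<and> u + w \<in> dom \<inter> chart -` U"
    using eventually_conj[OF C1(2) eventually_conj[OF C2(2) eventually_conj[OF C3(2) ev]]]
    unfolding eventually_nhds_metric by blast
  have MN: "M w = N w" if "dist w 0 < \<epsilon>" for w
  proof -
    have uw: "u + w \<in> dom" "chart (u + w) \<in> U" using near[OF that] by auto
    then have "chart (u + w) \<in> frontier \<Omega>" using chart_dom by blast
    then have "f (chart (u + w)) = F (chart (u + w))" "f (chart u) = F (chart u)"
      using fF uw U(2) \<open>chart u \<in> frontier \<Omega>\<close> by auto
    moreover have "H 0 = F (chart u)" using jac_ge_1[of u] by (simp add: H_def)
    ultimately show ?thesis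
      unfolding M_def numerator_chart[OF n[OF u] n[OF uw(1)]] by (simp add: N_def H_def)
  qed
  define C where "C = C1 + C2 + C3"
  have C: "C > 0" "C1 \<le> C" "C2 \<le> C" "C3 \<le> C" using C1(1) C2(1) C3(1) by (auto simp: C_def)
  show thesis
  proof (rule that[of \<epsilon> C])
    show "ball u \<epsilon> \<subseteq> dom"
    proof
      fix v assume "v \<in> ball u \<epsilon>"
      then have "dist (v - u) 0 < \<epsilon>" by (simp add: dist_norm norm_minus_commute)
      from near[OF this] show "v \<in> dom" by simp
    qed
    fix w :: "real^2" assume "w \<in> ball 0 \<epsilon>"
    then have w: "dist w 0 < \<epsilon>" "dist (- w) 0 < \<epsilon>" by (simp_all add: dist_norm)
    note b = near[OF w(1)]
    have le: "c * norm w ^ k \<le> C * norm w ^ k" if "c \<le> C" for c k using that by (intro mult_right_mono) auto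
    show "\<bar>jac (u + w) * numerator n f (chart u) (chart (u + w))\<bar> \<le> C * norm w ^ 3"
      using b MN[OF w(1)] le[OF C(2), of 3] by (simp add: M_def)
    show "\<bar>jac (u + w) * numerator n f (chart u) (chart (u + w))
        + jac (u + - w) * numerator n f (chart u) (chart (u + - w))\<bar> \<le> C * norm w ^ 4"
      using b MN[OF w(1)] MN[OF w(2)] le[OF C(3), of 4] by (simp add: M_def)
    show "\<bar>norm (chart (u + w) - chart u) - norm (chart (u + - w) - chart u)\<bar> \<le> C * norm w ^ 2"
    proof (cases "w = 0")
      case False
      let ?a = "norm (z w)" and ?b = "norm (z (- w))"
      have ge: "norm w \<le> ?a" "0 \<le> ?b" using norm_le_chart_diff[of w u] by (simp_all add: z_def)
      \<comment> \<open>pass from squared distances to distances, using that their sum is at least \<open>norm w\<close>\<close>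
      have "\<bar>?a - ?b\<bar> * norm w \<le> \<bar>?a - ?b\<bar> * (?a + ?b)"
      proof (rule mult_left_mono)
        show "norm w \<le> ?a + ?b" using ge by linarith
      qed simp
      also have "\<dots> = \<bar>(?a + ?b) * (?a - ?b)\<bar>"
        by (simp add: abs_mult mult.commute)
      also have "\<dots> = \<bar>?a\<^sup>2 - ?b\<^sup>2\<bar>"
        by (simp only: power2_eq_square square_diff_square_factored)
      also have "\<dots> \<le> C * norm w ^ 3" using b le[OF C(4), of 3] by linarith
      also have "\<dots> = (C * norm w ^ 2) * norm w" by (simp add: power2_eq_square power3_eq_cube)
      finally show ?thesis using False by (simp add: z_def)
    qed simp
  qed (use \<epsilon> C in auto)
qed

section \<open>The regularization error near a boundary point\<close>

lemma continuous_out_normal: "continuous_on (ball p r) (\<lambda>x. out_normal (proj x))"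
proof -
  have grad: "continuous_on UNIV grad"
    unfolding grad_def[abs_def]
    by (rule continuous_on_sum, rule continuous_on_scaleR[OF _ continuous_on_const],
        rule smooth_on_imp_continuous_on, rule smooth_on_dir_deriv, rule smooth_height)
  have emb: "continuous_on UNIV (\<lambda>v. emb (grad v))"
    by (rule continuous_on_compose2[OF linear_continuous_on[OF bounded_linear_emb] grad subset_UNIV])
  have "jac v \<noteq> 0" for v using jac_ge_1[of v] by auto
  then have "continuous_on UNIV (\<lambda>v. inverse (jac v))"
    by (intro continuous_on_inverse continuous_jac) simp
  from continuous_on_scaleR[OF this continuous_on_diff[OF emb continuous_on_const[of _ e]]]
  have "continuous_on UNIV out_normal"
    unfolding out_normal_def[abs_def] .
  then show ?thesis
    by (rule continuous_on_compose2[OF _ linear_continuous_on[OF bounded_linear_proj] subset_UNIV])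
qed

text \<open>With \<open>M\<close> the numerator times the area element and \<open>G\<close> the kernel difference, the symmetrized integrand is
  \<open>(M w + M (-w)) G w + M (-w) (G (-w) - G w)\<close>. The first product is of order \<open>4 - 3\<close>, the second of order
  \<open>3 + 2 - 4\<close>, each with the decay in \<open>|w|/\<delta>\<close>. The function \<open>h\<close> is prescribed only on \<open>Q\<close>, so that it can be a
  globally Borel measurable extension of the integrand.\<close>

lemma regularization_error_near:
  assumes p: "p \<in> frontier \<Omega>" and f: "smooth_on_subset (frontier \<Omega>) f"
    and n: "\<And>v. v \<in> dom \<Longrightarrow> n (chart v) = out_normal v"
  obtains c C Q where "c > 0" "C > 0" "Q \<in> sets borel" "Q \<subseteq> frontier \<Omega>" "frontier \<Omega> \<inter> ball p c \<subseteq> Q"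
    "\<And>x. x \<in> Q \<Longrightarrow> \<bar>numerator n f p x\<bar> \<le> C * norm (x - p) ^ 3"
    "\<And>\<delta> h. \<delta> > 0 \<Longrightarrow> h \<in> borel_measurable borel \<Longrightarrow>
        (\<And>x. x \<in> Q \<Longrightarrow> h x = numerator n f p x * ((s_factor (norm (x - p) / \<delta>) - 1) / norm (x - p) ^ 3)) \<Longrightarrow>
        \<bar>LINT x:Q|surface_measure (frontier \<Omega>). h x\<bar> \<le> C * \<delta> ^ 3"
proof -
  define u where "u = proj p"
  have pu: "chart u = p"
    using frontier_iff[of p] chart_proj[of p] p r_pos by (simp add: u_def)
  have u: "u \<in> dom" using r_pos by (simp add: dom_def pu)
  obtain \<epsilon> C where \<epsilon>: "\<epsilon> > 0" and C: "C > 0" and sub: "ball u \<epsilon> \<subseteq> dom"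
    and M3: "\<And>w. w \<in> ball 0 \<epsilon> \<Longrightarrow> \<bar>jac (u + w) * numerator n f p (chart (u + w))\<bar> \<le> C * norm w ^ 3"
    and M4: "\<And>w. w \<in> ball 0 \<epsilon> \<Longrightarrow> \<bar>jac (u + w) * numerator n f p (chart (u + w))
        + jac (u + - w) * numerator n f p (chart (u + - w))\<bar> \<le> C * norm w ^ 4"
    and D2: "\<And>w. w \<in> ball 0 \<epsilon> \<Longrightarrow> \<bar>norm (chart (u + w) - p) - norm (chart (u + - w) - p)\<bar> \<le> C * norm w ^ 2"
    using local_expansion[where n = n, OF u f n] unfolding pu by blast
  obtain B where B: "B > 0"
    and G3: "\<And>\<delta> d r. \<lbrakk>0 < \<delta>; 0 < d; d \<le> r\<rbrakk> \<Longrightarrow>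
        \<bar>(s_factor (r / \<delta>) - 1) / r ^ 3\<bar> \<le> B / (1 + (d / \<delta>)\<^sup>2) ^ 3 / d ^ 3"
    and G4: "\<And>\<delta> d r r'. \<lbrakk>0 < \<delta>; 0 < d; d \<le> r; d \<le> r'\<rbrakk> \<Longrightarrow>
        \<bar>(s_factor (r / \<delta>) - 1) / r ^ 3 - (s_factor (r' / \<delta>) - 1) / r' ^ 3\<bar>
          \<le> \<bar>r - r'\<bar> * (B / (1 + (d / \<delta>)\<^sup>2) ^ 3 / d ^ 4)"
    using regularized_kernel_bounds by blast
  obtain I where I: "I > 0" "\<And>\<delta>. \<delta> > 0 \<Longrightarrow>
    (\<integral>\<^sup>+w. ennreal (norm (w :: real^2) / (1 + (norm w / \<delta>)\<^sup>2) ^ 3) \<partial>lborel) \<le> ennreal (I * \<delta> ^ 3)"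
    using decay_integral_bound by blast
  let ?M = "\<lambda>w. jac (u + w) * numerator n f p (chart (u + w))"
  let ?\<rho> = "\<lambda>w. norm (chart (u + w) - p)"
  have \<rho>: "norm w \<le> ?\<rho> w" for w using norm_le_chart_diff[of w u] by (simp add: pu)
  define Q where "Q = chart ` ball u \<epsilon>"
  define E where "E = C * B + C * C * B"
  have E: "E > 0" using B C by (simp add: E_def add_pos_pos)
  show thesis
  proof (rule that[of "min \<epsilon> r" "max C (E * I)" Q])
    show "min \<epsilon> r > 0" "max C (E * I) > 0" using \<epsilon> r_pos C by auto
    show "Q \<in> sets borel" unfolding Q_def by (rule chart_image_borel[OF open_ball sub])
    show "Q \<subseteq> frontier \<Omega>" using sub chart_dom unfolding Q_def by blast
    show "frontier \<Omega> \<inter> ball p (min \<epsilon> r) \<subseteq> Q"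
    proof
      fix x assume x: "x \<in> frontier \<Omega> \<inter> ball p (min \<epsilon> r)"
      then have "x \<in> ball p r" "x \<in> frontier \<Omega>" by auto
      then have "chart (proj x) = x" using frontier_iff chart_proj by blast
      moreover have "norm (proj x - u) \<le> norm (x - p)"
        using norm_proj_le[of "x - p"] by (simp add: u_def linear_diff[OF linear_proj])
      then have "proj x \<in> ball u \<epsilon>" using x by (simp add: dist_norm norm_minus_commute)
      ultimately show "x \<in> Q" unfolding Q_def by (metis imageI)
    qed
    show "\<bar>numerator n f p x\<bar> \<le> max C (E * I) * norm (x - p) ^ 3" if x: "x \<in> Q" for x
    proof -
      obtain v where v: "v \<in> ball u \<epsilon>" "x = chart v" using x unfolding Q_def by blast
      define w where "w = v - u"
      have w: "w \<in> ball 0 \<epsilon>" "x = chart (u + w)"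
        using v by (simp_all add: w_def dist_norm norm_minus_commute)
      have "1 * \<bar>numerator n f p x\<bar> \<le> jac (u + w) * \<bar>numerator n f p x\<bar>"
        by (rule mult_right_mono) (use jac_ge_1 in auto)
      also have "\<dots> \<le> C * norm w ^ 3"
        using M3[OF w(1)] jac_nonneg[of "u + w"] by (simp add: w(2) abs_mult)
      also have "\<dots> \<le> max C (E * I) * norm (x - p) ^ 3"
        using \<rho>[of w] C by (intro mult_mono power_mono) (auto simp: w(2))
      finally show ?thesis by simp
    qed
    fix \<delta> :: real and h :: "real^3 \<Rightarrow> real"
    assume \<delta>: "\<delta> > 0" and h [measurable]: "h \<in> borel_measurable borel"
      and heq: "\<And>x. x \<in> Q \<Longrightarrow> h x = numerator n f p x * ((s_factor (norm (x - p) / \<delta>) - 1) / norm (x - p) ^ 3)"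
    let ?G = "\<lambda>w. (s_factor (?\<rho> w / \<delta>) - 1) / ?\<rho> w ^ 3"
    let ?k = "\<lambda>w. norm w / (1 + (norm w / \<delta>)\<^sup>2) ^ 3"
    have kernel: "jac (u + w) * h (chart (u + w)) = ?M w * ?G w" if "w \<in> ball 0 \<epsilon>" for w
    proof -
      have "chart (u + w) \<in> Q" using that by (auto simp: Q_def dist_norm)
      then show ?thesis by (simp add: heq)
    qed
    have "\<bar>LINT w:ball 0 \<epsilon>|lborel. jac (u + w) * h (chart (u + w))\<bar> \<le> E * I * \<delta> ^ 3"
    proof (rule symmetrized_integral_bound)
      fix w :: "real^2" assume w: "w \<in> ball 0 \<epsilon>"
      then have w': "- w \<in> ball 0 \<epsilon>" by (simp add: dist_norm)
      have "\<bar>?M w * ?G w + ?M (- w) * ?G (- w)\<bar> \<le> E * ?k w"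
      proof (cases "w = 0")
        case True
        then show ?thesis using M3[OF w] by auto
      next
        case False
        then have pos: "norm w > 0" by simp
        have \<rho>': "norm w \<le> ?\<rho> (- w)" using \<rho>[of "- w"] by simp
        define q where "q = B / (1 + (norm w / \<delta>)\<^sup>2) ^ 3"
        have q0: "q \<ge> 0" using B by (simp add: q_def)
        have "\<bar>?G (- w) - ?G w\<bar> \<le> \<bar>?\<rho> (- w) - ?\<rho> w\<bar> * (q / norm w ^ 4)"
          unfolding q_def by (rule G4[OF \<delta> pos \<rho>' \<rho>])
        also have "\<dots> \<le> (C * norm w ^ 2) * (q / norm w ^ 4)"
        proof (rule mult_right_mono)
          show "\<bar>?\<rho> (- w) - ?\<rho> w\<bar> \<le> C * norm w ^ 2"
            using D2[OF w] by (simp only: abs_minus_commute)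
        qed (use q0 in simp)
        finally have "\<bar>?G (- w) - ?G w\<bar> \<le> (C * norm w ^ 2) * (q / norm w ^ 4)" .
        moreover have "\<bar>?G w\<bar> \<le> q / norm w ^ 3"
          unfolding q_def by (rule G3[OF \<delta> pos \<rho>])
        moreover have "\<bar>?M (- w)\<bar> \<le> C * norm w ^ 3"
          using M3[OF w'] by (simp only: norm_minus_cancel)
        ultimately have "\<bar>?M w * ?G w + ?M (- w) * ?G (- w)\<bar> \<le> (C * norm w ^ 4) * (q / norm w ^ 3)
            + (C * norm w ^ 3) * ((C * norm w ^ 2) * (q / norm w ^ 4))"
          by (intro abs_symmetrized_product_le M4[OF w])
        also have "\<dots> = (C * q + C * C * q) * norm w"
          using pos by (simp add: field_simps eval_nat_numeral)
        also have "\<dots> = E * ?k w" unfolding E_def q_def by (simp only: times_divide_eq_right times_divide_eq_left distrib_right add_divide_distrib mult.assoc)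
        finally show ?thesis .
      qed
      then show "\<bar>jac (u + w) * h (chart (u + w)) + jac (u + - w) * h (chart (u + - w))\<bar> \<le> E * ?k w"
        by (simp only: kernel[OF w] kernel[OF w'])
    next
      show "0 \<le> E * ?k w" for w :: "real^2" using E by simp
      have "(\<integral>\<^sup>+w. ennreal (E * ?k (w :: real^2)) \<partial>lborel) = ennreal E * (\<integral>\<^sup>+w. ennreal (?k (w :: real^2)) \<partial>lborel)"
      proof -
        have "ennreal (E * ?k w) = ennreal E * ennreal (?k w)" for w :: "real^2"
          by (rule ennreal_mult') (use E in simp)
        then show ?thesis by (simp only:) (rule nn_integral_cmult, measurable)
      qed
      also have "\<dots> \<le> ennreal E * ennreal (I * \<delta> ^ 3)" by (intro mult_left_mono I(2) \<delta>) simp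
      also have "\<dots> = ennreal (E * I * \<delta> ^ 3)" using E by (simp add: ennreal_mult' mult.assoc)
      finally show "(\<integral>\<^sup>+w. ennreal (E * ?k (w :: real^2)) \<partial>lborel) \<le> ennreal (E * I * \<delta> ^ 3)" .
      show "(\<lambda>w :: real^2. E * ?k w) \<in> borel_measurable borel" by measurable
      show "0 \<le> E * I * \<delta> ^ 3" using E I(1) \<delta> by simp
    qed
    also have "(LINT w:ball 0 \<epsilon>|lborel. jac (u + w) * h (chart (u + w))) = (LINT x:Q|surface_measure (frontier \<Omega>). h x)"
      unfolding Q_def surface_integral_chart[OF open_ball sub h] by (rule set_integral_translate[symmetric]) measurable
    also have "E * I * \<delta> ^ 3 \<le> max C (E * I) * \<delta> ^ 3" using \<delta> by (intro mult_right_mono) auto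
    finally show "\<bar>LINT x:Q|surface_measure (frontier \<Omega>). h x\<bar> \<le> max C (E * I) * \<delta> ^ 3" .
  qed
qed

end

section \<open>The regularization error over the whole surface\<close>

lemma continuous_on_locally_eq:
  fixes f :: "'a::t2_space \<Rightarrow> 'b::topological_space"
  assumes "\<And>p. p \<in> S \<Longrightarrow> \<exists>U g. open U \<and> p \<in> U \<and> continuous_on U g \<and> (\<forall>x\<in>S \<inter> U. f x = g x)"
  shows "continuous_on S f"
  unfolding continuous_on_eq_continuous_within
proof
  fix p assume p: "p \<in> S"
  obtain U g where U: "open U" "p \<in> U" and g: "continuous_on U g" and eq: "\<forall>x\<in>S \<inter> U. f x = g x"
    using assms[OF p] by blast
  have "continuous_on (S \<inter> U) f"
    using continuous_on_subset[OF g, of "S \<inter> U"] continuous_on_cong[OF refl, of "S \<inter> U" f g] eq by auto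
  then have "continuous (at p within S \<inter> U) f"
    using p U by (simp add: continuous_on_eq_continuous_within)
  then show "continuous (at p within S) f"
    using at_within_nhd[of p U "S \<inter> U" S] U by (simp add: continuous_within Int_ac)
qed

lemma continuous_on_smooth_subset:
  fixes f :: "'a::real_normed_vector \<Rightarrow> real"
  assumes "smooth_on_subset S f"
  shows "continuous_on S f"
proof (rule continuous_on_locally_eq)
  fix p assume "p \<in> S"
  then show "\<exists>U g. open U \<and> p \<in> U \<and> continuous_on U g \<and> (\<forall>x\<in>S \<inter> U. f x = g x)"
    using assms unfolding smooth_on_subset_def by (meson smooth_on_imp_continuous_on)
qed

lemma continuous_on_outward_normal:
  assumes \<Omega>: "smooth_boundary \<Omega>" "open \<Omega>"
    and n: "\<And>x. x \<in> frontier \<Omega> \<Longrightarrow> outward_unit_normal \<Omega> x (n x)"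
  shows "continuous_on (frontier \<Omega>) n"
proof (rule continuous_on_locally_eq)
  fix p assume "p \<in> frontier \<Omega>"
  then obtain r \<gamma> emb proj e where "graph_chart \<Omega> p r \<gamma> emb proj e"
    using smooth_boundary_graph_chart[OF \<Omega>] by blast
  then interpret graph_chart \<Omega> p r \<gamma> emb proj e .
  have "n x = out_normal (proj x)" if x: "x \<in> frontier \<Omega> \<inter> ball p r" for x
  proof -
    obtain u where u: "u \<in> dom" "x = chart u" using x chart_dom by blast
    then show ?thesis using outward_normal_chart[OF u(1)] n x by auto
  qed
  then show "\<exists>U g. open U \<and> p \<in> U \<and> continuous_on U g \<and> (\<forall>x\<in>frontier \<Omega> \<inter> U. n x = g x)"
    using continuous_out_normal r_pos by (intro exI[of _ "ball p r"] exI[of _ "\<lambda>x. out_normal (proj x)"]) auto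
qed

text \<open>By compactness finitely many charts cover the surface, and each has finite area.\<close>

lemma emeasure_surface_finite:
  assumes \<Omega>: "smooth_boundary \<Omega>" "open \<Omega>" "bounded \<Omega>"
    and sets: "sets (surface_measure (frontier \<Omega>)) = sets borel"
  shows "emeasure (surface_measure (frontier \<Omega>)) (frontier \<Omega>) < \<infinity>"
proof -
  let ?S = "frontier \<Omega>" and ?\<mu> = "surface_measure (frontier \<Omega>)"
  have "\<exists>r>0. emeasure ?\<mu> (?S \<inter> ball p r) < \<infinity>" if p: "p \<in> ?S" for p
  proof -
    obtain r \<gamma> emb proj e where "graph_chart \<Omega> p r \<gamma> emb proj e"
      using smooth_boundary_graph_chart[OF \<Omega>(1,2) p] by blast
    then interpret graph_chart \<Omega> p r \<gamma> emb proj e .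
    show ?thesis using r_pos emeasure_surface_measure_finite by blast
  qed
  then obtain r where r: "\<And>p. p \<in> ?S \<Longrightarrow> r p > 0" "\<And>p. p \<in> ?S \<Longrightarrow> emeasure ?\<mu> (?S \<inter> ball p (r p)) < \<infinity>"
    by metis
  have "compact ?S" using \<Omega>(3) by (rule compact_frontier_bounded)
  then obtain T where T: "T \<subseteq> ?S" "finite T" "?S \<subseteq> (\<Union>p\<in>T. ball p (r p))"
    by (rule compactE_image[of _ ?S "\<lambda>p. ball p (r p)"]) (use r(1) in auto)
  have m: "?S \<inter> ball p (r p) \<in> sets ?\<mu>" for p
    unfolding sets by (intro sets.Int) (auto simp: frontier_closed)
  have "emeasure ?\<mu> ?S = emeasure ?\<mu> (\<Union>p\<in>T. ?S \<inter> ball p (r p))"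
    by (rule arg_cong[where f = "emeasure ?\<mu>"]) (use T(3) in blast)
  also have "\<dots> \<le> (\<Sum>p\<in>T. emeasure ?\<mu> (?S \<inter> ball p (r p)))"
    by (rule emeasure_subadditive_finite[OF T(2)]) (use m in blast)
  also have "\<dots> < \<infinity>" using T(1) r(2) by (auto simp: ennreal_sum_less_top[OF T(2)])
  finally show ?thesis .
qed

theorem mainTheorem2:
  fixes \<Omega> S :: "(real^3) set" and n :: "real^3 \<Rightarrow> real^3" and f :: "real^3 \<Rightarrow> real" and y :: "real^3"
  assumes "smooth_bounded_domain \<Omega>"
    and "S = frontier \<Omega>"
    and "\<And>x. x \<in> S \<Longrightarrow> outward_unit_normal \<Omega> x (n x)"
    and "smooth_on_subset S f"
    and "y \<in> S"
  shows "(\<lambda>\<delta>. adjoint_double_layer_reg \<delta> S n f y - adjoint_double_layer S n f y)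
           \<in> O[at_right 0](\<lambda>\<delta>. \<delta> ^ 3)"
proof -
  define \<mu> where "\<mu> = surface_measure S"
  have \<Omega>: "smooth_boundary \<Omega>" "open \<Omega>" "bounded \<Omega>"
    using assms(1) by (auto simp: smooth_bounded_domain_def)
  have n: "outward_unit_normal \<Omega> x (n x)" if "x \<in> frontier \<Omega>" for x using assms(2,3) that by blast
  obtain r \<gamma> emb proj e where "graph_chart \<Omega> y r \<gamma> emb proj e"
    using smooth_boundary_graph_chart[OF \<Omega>(1,2)] assms(2,5) by blast
  then interpret graph_chart \<Omega> y r \<gamma> emb proj e .
  have sets [simp]: "sets \<mu> = sets borel" unfolding \<mu>_def assms(2) by (rule sets_surface_measure)
  have S: "compact S" "closed S" using compact_frontier_bounded[OF \<Omega>(3)] assms(2) by (auto simp: frontier_closed)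
  have fin: "emeasure \<mu> S < \<infinity>"
    unfolding \<mu>_def assms(2) by (rule emeasure_surface_finite[OF \<Omega> sets_surface_measure])
  obtain c C Q where c: "c > 0" and C: "C > 0" and Q: "Q \<in> sets borel" "Q \<subseteq> S" "S \<inter> ball y c \<subseteq> Q"
    and near: "\<And>x. x \<in> Q \<Longrightarrow> \<bar>numerator n f y x\<bar> \<le> C * norm (x - y) ^ 3"
    and near_int: "\<And>\<delta> h. \<delta> > 0 \<Longrightarrow> h \<in> borel_measurable borel \<Longrightarrow>
        (\<And>x. x \<in> Q \<Longrightarrow> h x = numerator n f y x * ((s_factor (norm (x - y) / \<delta>) - 1) / norm (x - y) ^ 3)) \<Longrightarrow>
        \<bar>LINT x:Q|\<mu>. h x\<bar> \<le> C * \<delta> ^ 3"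
  proof -
    have chart_normal: "n (chart v) = out_normal v" if "v \<in> dom" for v
    proof (rule outward_normal_chart[OF that n])
      show "chart v \<in> frontier \<Omega>" using that chart_dom by blast
    qed
    note local_error = regularization_error_near[where n = n, OF assms(5)[unfolded assms(2)] assms(4)[unfolded assms(2)] chart_normal,
        folded assms(2), folded \<mu>_def]
    show thesis
      apply (rule local_error, assumption)
      subgoal premises prems for c C Q by (rule that[of c C Q]; fact prems)
      done
  qed
  obtain B where B: "B > 0"
    and G: "\<And>\<delta> d r. \<lbrakk>0 < \<delta>; 0 < d; d \<le> r\<rbrakk> \<Longrightarrow>
        \<bar>(s_factor (r / \<delta>) - 1) / r ^ 3\<bar> \<le> B / (1 + (d / \<delta>)\<^sup>2) ^ 3 / d ^ 3"
    apply (rule regularized_kernel_bounds)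
    subgoal premises prems for B by (rule that[of B]; fact prems)
    done
  have num_cont: "continuous_on S (numerator n f y)"
    unfolding numerator_def[abs_def] assms(2)
    using continuous_on_outward_normal[OF \<Omega>(1,2) n] continuous_on_smooth_subset[OF assms(4)] assms(2)
    by (intro continuous_intros) auto
  obtain L where L: "L > 0" "\<And>x. x \<in> S \<Longrightarrow> \<bar>numerator n f y x\<bar> \<le> L"
  proof -
    have "bounded (numerator n f y ` S)"
      using S(1) num_cont by (intro compact_imp_bounded compact_continuous_image)
    then obtain L where L: "L > 0" "\<forall>z\<in>numerator n f y ` S. norm z \<le> L"
      unfolding bounded_pos by blast
    show thesis by (rule that[OF L(1)]) (use L(2) in auto)
  qed
  \<comment> \<open>the first summand serves near \<open>y\<close>, the second away from \<open>y\<close>\<close>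
  define K where "K = C + L / c ^ 3"
  have K: "\<bar>numerator n f y x / norm (x - y) ^ 3\<bar> \<le> K" if x: "x \<in> S" for x
  proof (cases "x \<in> Q")
    case True
    have "\<bar>numerator n f y x / norm (x - y) ^ 3\<bar> \<le> C"
      using near[OF True] C by (cases "x = y") (simp_all add: abs_divide pos_divide_le_eq)
    then show ?thesis using L(1) c by (simp add: K_def add_increasing2)
  next
    case False
    then have "c \<le> norm (x - y)" using Q(3) x by (auto simp: dist_norm norm_minus_commute not_less)
    then have "\<bar>numerator n f y x\<bar> / norm (x - y) ^ 3 \<le> L / c ^ 3"
      using L(1) L(2)[OF x] c by (intro frac_le power_mono) auto
    then show ?thesis using C by (simp add: K_def abs_divide)
  qed
  \<comment> \<open>cutting off to \<open>S - {y}\<close>, where the kernels are continuous, makes them Borel measurable on all of space\<close>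
  define k where "k x = indicator (S - {y}) x *\<^sub>R (numerator n f y x / norm (x - y) ^ 3)" for x
  define g where "g \<delta> x = indicator (S - {y}) x *\<^sub>R (numerator n f y x * ((s_factor (norm (x - y) / \<delta>) - 1) / norm (x - y) ^ 3))" for \<delta> x
  have k_eq: "k x = numerator n f y x / norm (x - y) ^ 3"
    and g_eq: "g \<delta> x = numerator n f y x * ((s_factor (norm (x - y) / \<delta>) - 1) / norm (x - y) ^ 3)"
    if "x \<in> S" for x \<delta>
    using that by (cases "x = y"; simp add: k_def g_def)+
  have Sy: "S - {y} \<in> sets borel" using S(2) by auto
  have num_cont': "continuous_on (S - {y}) (numerator n f y)"
    by (rule continuous_on_subset[OF num_cont]) blast
  have k_meas: "k \<in> borel_measurable borel"
    unfolding k_def[abs_def]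
    by (rule borel_measurable_continuous_on_indicator[OF Sy]) (intro continuous_intros num_cont'; simp)
  have g_meas: "g \<delta> \<in> borel_measurable borel" for \<delta>
  proof -
    have s: "continuous_on UNIV s_factor" using isCont_s_factor by (simp add: continuous_at_imp_continuous_on)
    have "continuous_on (S - {y}) (\<lambda>x. s_factor (norm (x - y) * inverse \<delta>))"
      by (rule continuous_on_compose2[OF s]) (intro continuous_intros, simp)
    then show ?thesis
      unfolding g_def[abs_def] divide_inverse[of _ \<delta>]
      by (intro borel_measurable_continuous_on_indicator[OF Sy] continuous_intros num_cont') auto
  qed
  have k_int: "set_integrable \<mu> S k"
    unfolding set_integrable_def
    by (rule integrableI_bounded_set_indicator[where B = K])
       (use S(2) fin K k_meas k_eq in \<open>auto simp: measurable_cong_sets[OF sets refl]\<close>)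
  have g_bound: "\<bar>g \<delta> x\<bar> \<le> K * B" if x: "x \<in> S" and \<delta>: "\<delta> > 0" for x \<delta>
  proof (cases "x = y")
    case False
    let ?\<rho> = "norm (x - y)"
    have \<rho>: "?\<rho> > 0" using False by simp
    have "B / (1 + (?\<rho> / \<delta>)\<^sup>2) ^ 3 \<le> B"
      using B divide_left_mono[of 1 "(1 + (?\<rho> / \<delta>)\<^sup>2) ^ 3" B] by (simp add: add_pos_nonneg)
    then have "B / (1 + (?\<rho> / \<delta>)\<^sup>2) ^ 3 / ?\<rho> ^ 3 \<le> B / ?\<rho> ^ 3"
      by (rule divide_right_mono) simp
    then have "\<bar>(s_factor (?\<rho> / \<delta>) - 1) / ?\<rho> ^ 3\<bar> \<le> B / ?\<rho> ^ 3"
      using G[OF \<delta> \<rho> order_refl] by linarith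
    then have "\<bar>g \<delta> x\<bar> \<le> \<bar>numerator n f y x\<bar> * (B / ?\<rho> ^ 3)"
      unfolding g_eq[OF x] abs_mult by (rule mult_left_mono) simp
    also have "\<dots> = \<bar>numerator n f y x / ?\<rho> ^ 3\<bar> * B" by (simp add: abs_divide)
    also have "\<dots> \<le> K * B" using K[OF x] B by (intro mult_right_mono) auto
    finally show ?thesis .
  qed (use K[OF x] B in \<open>simp add: g_def\<close>)
  have g_int: "set_integrable \<mu> S (g \<delta>)" if "\<delta> > 0" for \<delta>
    unfolding set_integrable_def
    by (rule integrableI_bounded_set_indicator[where B = "K * B"])
       (use S(2) fin g_bound[OF _ that] g_meas in \<open>auto simp: measurable_cong_sets[OF sets refl]\<close>)
  define m where "m = measure \<mu> S"
  have diff: "adjoint_double_layer_reg \<delta> S n f y - adjoint_double_layer S n f y = (LINT x:S|\<mu>. g \<delta> x) / (4 * pi)"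
    if \<delta>: "\<delta> > 0" for \<delta>
  proof -
    have "adjoint_double_layer S n f y = (LINT x:S|\<mu>. k x / (4 * pi)) + 1/2 * f y"
      unfolding adjoint_double_layer_def \<mu>_def[symmetric] numerator_def[symmetric]
      using S(2) by (intro arg_cong2[where f = "(+)"] set_lebesgue_integral_cong) (auto simp: k_eq)
    moreover have "adjoint_double_layer_reg \<delta> S n f y = (LINT x:S|\<mu>. k x / (4 * pi) + g \<delta> x / (4 * pi)) + 1/2 * f y"
      unfolding adjoint_double_layer_reg_def \<mu>_def[symmetric] numerator_def[symmetric]
      using S(2) by (intro arg_cong2[where f = "(+)"] set_lebesgue_integral_cong)
        (auto simp: k_eq g_eq algebra_simps diff_divide_distrib add_divide_distrib)
    moreover have "(LINT x:S|\<mu>. k x / (4 * pi) + g \<delta> x / (4 * pi)) = (LINT x:S|\<mu>. k x / (4 * pi)) + (LINT x:S|\<mu>. g \<delta> x / (4 * pi))"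
      using k_int g_int[OF \<delta>] by (intro set_integral_add) auto
    ultimately show ?thesis by simp
  qed
  \<comment> \<open>away from \<open>y\<close> the kernel difference is already of order \<open>\<delta>^3\<close> pointwise\<close>
  have far: "\<bar>LINT x:S - Q|\<mu>. g \<delta> x\<bar> \<le> L * B / c ^ 6 * m * \<delta> ^ 3" if \<delta>: "\<delta> > 0" for \<delta>
  proof -
    have bound: "\<bar>g \<delta> x\<bar> \<le> L * B / c ^ 6 * \<delta> ^ 3" if x: "x \<in> S - Q" for x
    proof -
      have xS: "x \<in> S" and dist: "c \<le> norm (x - y)"
        using Q(3) x by (auto simp: dist_norm norm_minus_commute not_less)
      have "c / \<delta> \<le> 1 + (c / \<delta>)\<^sup>2" by (rule le_one_plus_square)
      then have "(c / \<delta>) ^ 3 \<le> (1 + (c / \<delta>)\<^sup>2) ^ 3" using c \<delta> by (intro power_mono) auto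
      then have "B / (1 + (c / \<delta>)\<^sup>2) ^ 3 \<le> B / (c / \<delta>) ^ 3"
        using B c \<delta> by (intro divide_left_mono) (auto intro!: mult_pos_pos add_pos_nonneg)
      then have "B / (1 + (c / \<delta>)\<^sup>2) ^ 3 / c ^ 3 \<le> B / (c / \<delta>) ^ 3 / c ^ 3"
        using c by (intro divide_right_mono) auto
      also have "\<dots> = B / c ^ 6 * \<delta> ^ 3" using c \<delta> by (simp add: power_divide flip: power_add)
      finally have "\<bar>(s_factor (norm (x - y) / \<delta>) - 1) / norm (x - y) ^ 3\<bar> \<le> B / c ^ 6 * \<delta> ^ 3"
        using G[OF \<delta> c dist] by linarith
      then have "\<bar>g \<delta> x\<bar> \<le> L * (B / c ^ 6 * \<delta> ^ 3)"
        unfolding g_eq[OF xS] abs_mult using L(2)[OF xS] L(1) by (intro mult_mono) auto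
      then show ?thesis by simp
    qed
    have "\<bar>LINT x:S - Q|\<mu>. g \<delta> x\<bar> \<le> (LINT x|\<mu>. indicator S x *\<^sub>R (L * B / c ^ 6 * \<delta> ^ 3))"
      unfolding set_lebesgue_integral_def
    proof (rule integral_abs_bound_integral)
      have "set_integrable \<mu> (S - Q) (g \<delta>)"
        by (rule set_integrable_subset[OF g_int[OF \<delta>]]) (use S(2) Q(1) in auto)
      then show "integrable \<mu> (\<lambda>x. indicator (S - Q) x *\<^sub>R g \<delta> x)" by (simp add: set_integrable_def)
      show "integrable \<mu> (\<lambda>x. indicator S x *\<^sub>R (L * B / c ^ 6 * \<delta> ^ 3))"
        using S(2) fin by (intro integrable_scaleR_left) (auto simp: integrable_indicator_iff)
      show "\<bar>indicator (S - Q) x *\<^sub>R g \<delta> x\<bar> \<le> indicator S x *\<^sub>R (L * B / c ^ 6 * \<delta> ^ 3)" for x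
        using bound[of x] L(1) B c \<delta> by (auto simp: indicator_def)
    qed
    also have "\<dots> = L * B / c ^ 6 * m * \<delta> ^ 3"
    proof -
      have "S \<inter> space \<mu> = S" using sets_eq_imp_space_eq[OF sets] by simp
      then show ?thesis by (simp add: m_def)
    qed
    finally show ?thesis .
  qed
  have total: "\<bar>adjoint_double_layer_reg \<delta> S n f y - adjoint_double_layer S n f y\<bar> \<le> (C + L * B / c ^ 6 * m) * \<delta> ^ 3"
    if \<delta>: "\<delta> > 0" for \<delta>
  proof -
    have "(LINT x:S|\<mu>. g \<delta> x) = (LINT x:Q|\<mu>. g \<delta> x) + (LINT x:S - Q|\<mu>. g \<delta> x)"
    proof -
      have "set_integrable \<mu> Q (g \<delta>)" "set_integrable \<mu> (S - Q) (g \<delta>)"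
        by (rule set_integrable_subset[OF g_int[OF \<delta>]]; use S(2) Q in auto)+
      then have "(LINT x:Q \<union> (S - Q)|\<mu>. g \<delta> x) = (LINT x:Q|\<mu>. g \<delta> x) + (LINT x:S - Q|\<mu>. g \<delta> x)"
        by (intro set_integral_Un) auto
      moreover have "Q \<union> (S - Q) = S" using Q(2) by blast
      ultimately show ?thesis by simp
    qed
    moreover have "\<bar>LINT x:Q|\<mu>. g \<delta> x\<bar> \<le> C * \<delta> ^ 3"
      by (rule near_int[OF \<delta> g_meas]) (use Q(2) g_eq in blast)
    ultimately have "\<bar>LINT x:S|\<mu>. g \<delta> x\<bar> \<le> C * \<delta> ^ 3 + L * B / c ^ 6 * m * \<delta> ^ 3"
      using far[OF \<delta>] by linarith
    also have "\<dots> = (C + L * B / c ^ 6 * m) * \<delta> ^ 3" by (simp only: distrib_right)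
    finally have le: "\<bar>LINT x:S|\<mu>. g \<delta> x\<bar> \<le> (C + L * B / c ^ 6 * m) * \<delta> ^ 3" .
    have "\<bar>(LINT x:S|\<mu>. g \<delta> x) / (4 * pi)\<bar> \<le> \<bar>LINT x:S|\<mu>. g \<delta> x\<bar>"
      using pi_ge_two by (simp add: abs_divide abs_mult pos_divide_le_eq mult_le_cancel_left1)
    then show ?thesis unfolding diff[OF \<delta>] using le by linarith
  qed
  show ?thesis
    by (rule bigoI[of _ "C + L * B / c ^ 6 * m"])
       (use eventually_at_right_less[of 0] total in \<open>auto elim!: eventually_mono\<close>)
qed

end
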